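(* Let $G=(V,E)$ be a finite simple graph with $n=|V|$ vertices, minimum degree $d$ and maximum degree $\Delta$, and let $k\geq 2$ be an integer. Let $G^{(k)}$ be the random $k$-lift of $G$ determined by random matchings $\{\mathcal{M}_{vw}\}_{vw\in E}$, where the matchings $\mathcal{M}_{vw}$ are chosen independently and, for each $vw\in E$ and all $\ell,r\in[k]$, $$\Pr\big[\{(v,\ell),(w,r)\}\in\mathcal{M}_{vw}\big]=\frac1k.$$ Let $A$, $A^{(k)}$ be the adjacency matrices and $\mathcal{L}$, $\mathcal{L}^{(k)}$ the Laplacians of $G$ and $G^{(k)}$ respectively. Then for all $\delta\in(0,1)$, $$\Pr\Big[\sup_{\eta\in \mathrm{new}(A^{(k)})}|\eta|\leq 16\sqrt{\Delta\ln(2nk/\delta)}\Big]\geq 1-\delta$$ and $$\Pr\Big[\sup_{\beta\in \mathrm{new}(\mathcal{L}^{(k)})}|1-\beta|\leq 16\sqrt{\frac{\ln(2nk/\delta)}{d}}\Big]\geq 1-\delta.$$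
   Context: A $k$-lift of $G$ is a graph $G^{(k)}$ with vertex set $V\times[k]$ and edge set $\bigcup_{vw\in E}\mathcal{M}_{vw}$, where each $\mathcal{M}_{vw}$ is a perfect matching between the sets $\{(v,1),\dots,(v,k)\}$ and $\{(w,1),\dots,(w,k)\}$. The degree of a vertex is its number of neighbours. For a graph with adjacency matrix $A$ on $m$ vertices, the Laplacian is $\mathcal{L}=I_m-TAT$, where $T$ is diagonal with entry $\deg(v)^{-1/2}$ if $\deg(v)\neq0$ and $0$ otherwise. The spectrum $\mathrm{spec}(M)$ of a real symmetric matrix $M$ is the multiset of its eigenvalues, each counted with its multiplicity. For multisets $S_1,S_2$ of reals, $S_2\setminus S_1$ is the multiset in which each $x$ has multiplicity $\max\{m_{S_2}(x)-m_{S_1}(x),0\}$. Define $\mathrm{new}(A^{(k)})=\mathrm{spec}(A^{(k)})\setminus\mathrm{spec}(A)$ and $\mathrm{new}(\mathcal{L}^{(k)})=\mathrm{spec}(\mathcal{L}^{(k)})\setminus\mathrm{spec}(\mathcal{L})$. *)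

theory Defs
  imports "HOL-Probability.Probability"
begin

(* A graph on the vertex set UNIV :: 'v set is given by its set of edges, each edge being the set
   of its two ends. *)

definition simple_graph :: "'v set set \<Rightarrow> bool" where
  "simple_graph E \<longleftrightarrow> (\<forall>e\<in>E. card e = 2)"

definition vdegree :: "'v set set \<Rightarrow> 'v \<Rightarrow> nat" where
  "vdegree E v = card {w. {v, w} \<in> E}"

definition min_degree :: "'v::finite set set \<Rightarrow> nat" where
  "min_degree E = Min (range (vdegree E))"

definition max_degree :: "'v::finite set set \<Rightarrow> nat" where
  "max_degree E = Max (range (vdegree E))"

definition adj_matrix :: "'v::finite set set \<Rightarrow> real^'v^'v" where
  "adj_matrix E = (\<chi> v w. if {v, w} \<in> E then 1 else 0)"

definition inv_sqrt_degree_matrix :: "'v::finite set set \<Rightarrow> real^'v^'v" where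
  "inv_sqrt_degree_matrix E =
     (\<chi> v w. if v = w \<and> vdegree E v \<noteq> 0 then 1 / sqrt (real (vdegree E v)) else 0)"

definition laplacian :: "'v::finite set set \<Rightarrow> real^'v^'v" where
  "laplacian E =
     mat 1 - inv_sqrt_degree_matrix E ** adj_matrix E ** inv_sqrt_degree_matrix E"

(* The multiplicity of an eigenvalue is the dimension of its eigenspace; this is 0 for reals that
   are not eigenvalues. Meant for symmetric matrices, see count_spec_mset. *)

definition eigenspace :: "real^'n^'n \<Rightarrow> real \<Rightarrow> (real^'n::finite) set" where
  "eigenspace M x = {u. M *v u = x *\<^sub>R u}"

definition spec_mset :: "real^'n::finite^'n \<Rightarrow> real multiset" where
  "spec_mset M = Abs_multiset (\<lambda>x. dim (eigenspace M x))"

lemma finite_eigenvalues: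
  fixes M :: "real^'n::finite^'n"
  assumes "transpose M = M"
  shows "finite {x. 0 < dim (eigenspace M x)}"
proof -
  let ?S = "{x. 0 < dim (eigenspace M x)}"
  have "\<exists>u. u \<noteq> 0 \<and> M *v u = x *\<^sub>R u" if "x \<in> ?S" for x
  proof (rule ccontr)
    assume "\<not> ?thesis"
    then have "eigenspace M x \<subseteq> {0}"
      by (auto simp: eigenspace_def)
    with that show False
      by (simp flip: dim_eq_0)
  qed
  then obtain u where u: "\<And>x. x \<in> ?S \<Longrightarrow> u x \<noteq> 0 \<and> M *v u x = x *\<^sub>R u x"
    by metis
  have orth: "u x \<bullet> u y = 0" if "x \<in> ?S" "y \<in> ?S" "x \<noteq> y" for x y
  proof -
    have "x * (u x \<bullet> u y) = (M *v u x) \<bullet> u y"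
      using u[OF that(1)] by simp
    also have "\<dots> = u x \<bullet> (M *v u y)"
      using assms by (metis dot_lmul_matrix transpose_matrix_vector)
    also have "\<dots> = y * (u x \<bullet> u y)"
      using u[OF that(2)] by simp
    finally show ?thesis
      using that(3) by simp
  qed
  have "inj_on u ?S"
    by (rule inj_onI) (metis orth u inner_eq_zero_iff)
  moreover have "independent (u ` ?S)"
  proof (rule pairwise_orthogonal_independent)
    show "pairwise orthogonal (u ` ?S)"
      unfolding pairwise_def orthogonal_def using orth by (metis (no_types, lifting) imageE)
    show "0 \<notin> u ` ?S"
      using u by force
  qed
  ultimately show ?thesis
    using independent_imp_finite finite_imageD by blast
qed

lemma count_spec_mset:
  assumes "transpose M = M"
  shows "count (spec_mset M) x = dim (eigenspace M x)"
  unfolding spec_mset_def using finite_eigenvalues[OF assms] by simp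

lemma transpose_adj_matrix: "transpose (adj_matrix E) = adj_matrix E"
  by (simp add: transpose_def adj_matrix_def insert_commute)

lemma transpose_laplacian: "transpose (laplacian E) = laplacian E"
proof -
  have T: "transpose (inv_sqrt_degree_matrix E) = inv_sqrt_degree_matrix E"
    by (auto simp: transpose_def inv_sqrt_degree_matrix_def vec_eq_iff)
  have "transpose (A - B) = transpose A - transpose B" for A B :: "real^'a^'a"
    by (simp add: transpose_def vec_eq_iff)
  then show ?thesis
    by (simp add: laplacian_def matrix_transpose_mul T transpose_adj_matrix matrix_mul_assoc)
qed

definition perfect_matching_between :: "'u set \<Rightarrow> 'u set \<Rightarrow> 'u set set \<Rightarrow> bool" where
  "perfect_matching_between X Y m \<longleftrightarrow>
     (\<forall>e\<in>m. \<exists>x\<in>X. \<exists>y\<in>Y. e = {x, y}) \<and> (\<forall>z\<in>X \<union> Y. \<exists>!e. e \<in> m \<and> z \<in> e)"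

definition fibre :: "'v \<Rightarrow> ('v \<times> 'k) set" where
  "fibre v = {v} \<times> UNIV"

(* The index set [k] is represented by a finite type 'k with k elements. *)

definition lift_matchings :: "'v set set \<Rightarrow> ('v set \<Rightarrow> ('v \<times> 'k) set set) \<Rightarrow> bool" where
  "lift_matchings E m \<longleftrightarrow>
     (\<forall>v w. {v, w} \<in> E \<longrightarrow> perfect_matching_between (fibre v) (fibre w) (m {v, w}))"

definition lift_edges :: "'v set set \<Rightarrow> ('v set \<Rightarrow> ('v \<times> 'k) set set) \<Rightarrow> ('v \<times> 'k) set set" where
  "lift_edges E m = (\<Union>e\<in>E. m e)"

(* Subtraction of multisets truncates multiplicities at 0. *)

definition new_adj :: "'v::finite set set \<Rightarrow> ('v \<times> 'k::finite) set set \<Rightarrow> real multiset" where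
  "new_adj E E' = spec_mset (adj_matrix E') - spec_mset (adj_matrix E)"

definition new_lap :: "'v::finite set set \<Rightarrow> ('v \<times> 'k::finite) set set \<Rightarrow> real multiset" where
  "new_lap E E' = spec_mset (laplacian E') - spec_mset (laplacian E)"

end

(* Let J be the all-ones matrix and P_e the permutation matrices of the lift. A new eigenvalue has an
   eigenvector whose sums over the fibres vanish, hence it is an eigenvalue of
   S = sum_e c_e (P_e - J/k), a sum of independent centred symmetric matrices (c = 1 for adjacency,
   c_vw = (deg v deg w)^(-1/2) for the Laplacian). With respect to the Frobenius norm, resampling one
   summand and a trace inequality give
     E ||S^(r+1)||^2 <= 2 (2r+1) sigma E ||S^r||^2,
   where sigma bounds the weighted degrees sum_(e at v) c_e^2, because then
   sum_e |c_e (P_e - J/k) u|^2 <= sigma |u|^2 for every outcome.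
   Markov's inequality for ||S^m||^2 with m = ceiling (ln (2nk/delta)) finishes the proof; neither
   the matrix exponential nor the spectral theorem is needed. *)

theory Submission
  imports Defs
begin

section \<open>Frobenius norm and powers of symmetric matrices\<close>

text \<open>Matrices carry the inner product A \<bullet> B = tr (A^T B), so traces appear only as
  inner products, and |S^m|^2 = tr S^(2m) for symmetric S. The obstacle is that S and its resampled
  version S' do not commute: with H = S - S', telescoping S^(2r+1) - S'^(2r+1) against H leaves
  mixed terms tr (H S^q H S'^(2r-q)). These have a Gram structure, so convexity bounds their sum by
  the two pure terms q = 0 and q = 2r, which have the same mean because (S, S') is exchangeable. A
  pure term is a squared norm such as |H S^r|^2, and it is estimated column by column by a quadratic
  form that depends on the edge but not on its matching. Hence the drawn and the resampled matching
  are treated alike, and the sum over all edges costs only \<sigma>, not the number of edges. The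
  dimension enters once, as |I|^2 = nk, and the logarithm absorbs it.\<close>

lemma inner_matrix_mult_left:
  fixes A :: "real^'n::finite^'m::finite" and B :: "real^'l::finite^'n"
  shows "(A ** B) \<bullet> C = B \<bullet> (transpose A ** C)"
proof -
  have "(A ** B) \<bullet> C = (\<Sum>i\<in>UNIV. \<Sum>j\<in>UNIV. \<Sum>k\<in>UNIV. A $ i $ k * B $ k $ j * C $ i $ j)"
    by (simp add: inner_vec_def matrix_matrix_mult_def sum_distrib_right)
  also have "\<dots> = (\<Sum>i\<in>UNIV. \<Sum>k\<in>UNIV. \<Sum>j\<in>UNIV. A $ i $ k * B $ k $ j * C $ i $ j)"
    by (intro sum.cong sum.swap refl)
  also have "\<dots> = (\<Sum>k\<in>UNIV. \<Sum>i\<in>UNIV. \<Sum>j\<in>UNIV. A $ i $ k * B $ k $ j * C $ i $ j)"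
    by (rule sum.swap)
  also have "\<dots> = (\<Sum>k\<in>UNIV. \<Sum>j\<in>UNIV. \<Sum>i\<in>UNIV. A $ i $ k * B $ k $ j * C $ i $ j)"
    by (intro sum.cong sum.swap refl)
  also have "\<dots> = B \<bullet> (transpose A ** C)"
    by (simp add: inner_vec_def matrix_matrix_mult_def transpose_def sum_distrib_left mult_ac)
  finally show ?thesis .
qed

lemma inner_transpose:
  fixes A B :: "real^'n::finite^'m::finite"
  shows "transpose A \<bullet> transpose B = A \<bullet> B"
  unfolding inner_vec_def transpose_def by (simp add: sum.swap[of _ "UNIV::'m set" "UNIV::'n set"])

lemma norm_transpose:
  fixes A :: "real^'n::finite^'m::finite"
  shows "norm (transpose A) = norm A"
  by (simp add: norm_eq_sqrt_inner inner_transpose)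

lemma inner_matrix_mult_right:
  fixes A :: "real^'n::finite^'m::finite" and B :: "real^'l::finite^'n"
  shows "(A ** B) \<bullet> C = A \<bullet> (C ** transpose B)"
proof -
  have "(A ** B) \<bullet> C = (transpose B ** transpose A) \<bullet> transpose C"
    by (metis inner_transpose matrix_transpose_mul)
  also have "\<dots> = transpose A \<bullet> (B ** transpose C)"
    by (simp add: inner_matrix_mult_left)
  also have "\<dots> = A \<bullet> (C ** transpose B)"
    by (metis inner_transpose matrix_transpose_mul transpose_transpose)
  finally show ?thesis .
qed

text \<open>Cauchy-Schwarz in each row: the Frobenius norm dominates the operator norm.\<close>

lemma norm_matrix_vector_mult_le:
  fixes A :: "real^'n::finite^'m::finite"
  shows "norm (A *v x) \<le> norm A * norm x"
proof -
  have "(norm (A *v x))\<^sup>2 = (\<Sum>i\<in>UNIV. (A $ i \<bullet> x)\<^sup>2)"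
    by (simp add: power2_norm_eq_inner inner_vec_def[of "A *v x"] matrix_vector_mul_component
        power2_eq_square[of "_ \<bullet> _"])
  also have "\<dots> \<le> (\<Sum>i\<in>UNIV. (A $ i \<bullet> A $ i) * (x \<bullet> x))"
    by (intro sum_mono Cauchy_Schwarz_ineq)
  also have "\<dots> = (norm A * norm x)\<^sup>2"
    by (simp add: power_mult_distrib power2_norm_eq_inner inner_vec_def[of A] sum_distrib_right)
  finally show ?thesis
    by (rule power2_le_imp_le) simp
qed

text \<open>Turns bounds on \<open>X *v u\<close> for single vectors into bounds on the Frobenius
  norm of a product with left factor X.\<close>

lemma norm_matrix_columns:
  fixes A :: "real^'n::finite^'m::finite"
  shows "(norm A)\<^sup>2 = (\<Sum>j\<in>UNIV. (norm (column j A))\<^sup>2)"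
  unfolding power2_norm_eq_inner inner_vec_def column_def
  by (simp add: sum.swap[of _ "UNIV::'m set" "UNIV::'n set"])

lemma column_matrix_mult: "column j (A ** B) = A *v column j B"
  by (simp add: column_def matrix_matrix_mult_def matrix_vector_mult_def vec_eq_iff)

section \<open>Powers of matrices and their eigenvalues\<close>

primrec matrix_power :: "real^'n::finite^'n \<Rightarrow> nat \<Rightarrow> real^'n^'n" where
  "matrix_power A 0 = mat 1"
| "matrix_power A (Suc n) = A ** matrix_power A n"

lemma matrix_power_add: "matrix_power A (m + n) = matrix_power A m ** matrix_power A n"
  by (induction m) (simp_all add: matrix_mul_assoc)

lemma matrix_power_Suc2: "matrix_power A (Suc n) = matrix_power A n ** A"
  using matrix_power_add[of A n 1] by simp

lemma transpose_matrix_power: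
  "transpose A = A \<Longrightarrow> transpose (matrix_power A n) = matrix_power A n"
  by (induction n) (simp_all add: transpose_mat matrix_transpose_mul flip: matrix_power_Suc2)

lemma matrix_power_eigenvector: "A *v u = x *\<^sub>R u \<Longrightarrow> matrix_power A n *v u = x ^ n *\<^sub>R u"
  by (induction n) (simp_all add: matrix_vector_mul_assoc[symmetric] matrix_vector_mult_scaleR)

text \<open>A single eigenvector suffices, since \<open>matrix_power A n\<close> scales it by
  \<open>x ^ n\<close>.\<close>

lemma eigenvalue_power_le_norm:
  assumes "A *v u = x *\<^sub>R u" "u \<noteq> 0"
  shows "\<bar>x\<bar> ^ n \<le> norm (matrix_power A n)"
  using norm_matrix_vector_mult_le[of "matrix_power A n" u] matrix_power_eigenvector[OF assms(1), of n]
    assms(2) by (simp add: power_abs)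

lemma matrix_mult_diff_left: "A ** (B - C) = A ** B - A ** (C :: real^'n::finite^'n)"
  by (simp add: matrix_matrix_mult_def vec_eq_iff right_diff_distrib sum_subtractf)

lemma matrix_mult_diff_right: "(B - C) ** A = B ** A - (C :: real^'n::finite^'n) ** A"
  by (simp add: matrix_matrix_mult_def vec_eq_iff left_diff_distrib sum_subtractf)

lemma matrix_mult_sum_right:
  "finite S \<Longrightarrow> A ** (\<Sum>i\<in>S. f i) = (\<Sum>i\<in>S. A ** (f i :: real^'n::finite^'n))"
  by (induction S rule: finite_induct) (simp_all add: matrix_add_ldistrib)

text \<open>Non-commutative telescoping: the factors A are replaced by B one at a time.\<close>

lemma matrix_power_diff:
  "matrix_power A (Suc n) - matrix_power B (Suc n) =
    (\<Sum>q\<le>n. matrix_power A q ** (A - B) ** matrix_power B (n - q))"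
proof (induction n)
  case (Suc n)
  have "matrix_power A (Suc (Suc n)) - matrix_power B (Suc (Suc n)) =
      A ** (matrix_power A (Suc n) - matrix_power B (Suc n)) + (A - B) ** matrix_power B (Suc n)"
    by (simp add: matrix_mult_diff_left matrix_mult_diff_right)
  also have "A ** (matrix_power A (Suc n) - matrix_power B (Suc n)) =
      (\<Sum>q\<le>n. matrix_power A (Suc q) ** (A - B) ** matrix_power B (n - q))"
    unfolding Suc.IH
    by (simp add: matrix_mult_sum_right matrix_mul_assoc)
  finally show ?case
    by (simp add: sum.atMost_Suc_shift del: matrix_power.simps(2) sum.atMost_Suc)
qed simp

text \<open>Discrete maximum principle: at an interior leftmost maximum the left neighbour is
  strictly smaller and the right one not larger, against midpoint convexity.\<close>

lemma convex_sequence_le_max: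
  fixes c :: "nat \<Rightarrow> real"
  assumes conv: "\<And>i. 0 < i \<Longrightarrow> i < r \<Longrightarrow> 2 * c i \<le> c (i - 1) + c (i + 1)" and "i \<le> r"
  shows "c i \<le> max (c 0) (c r)"
proof -
  define m where "m = Max (c ` {..r})"
  have m: "c j \<le> m" if "j \<le> r" for j
    using that by (simp add: m_def)
  have "m \<in> c ` {..r}"
    unfolding m_def by (rule Max_in) auto
  then have ex: "\<exists>j. j \<le> r \<and> c j = m"
    by auto
  define j where "j = (LEAST j. j \<le> r \<and> c j = m)"
  have j: "j \<le> r" "c j = m"
    using LeastI_ex[OF ex] by (simp_all add: j_def)
  have "j = 0 \<or> j = r"
  proof (rule ccontr)
    assume *: "\<not> ?thesis"
    then have "c (j - 1) \<noteq> m"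
      using not_less_Least[of "j - 1" "\<lambda>j. j \<le> r \<and> c j = m"] j(1) by (auto simp: j_def)
    moreover have "c (j - 1) \<le> m" "c (j + 1) \<le> m"
      using j * by (intro m; simp)+
    ultimately show False
      using conv[of j] j * by linarith
  qed
  then show ?thesis
    using j m[OF \<open>i \<le> r\<close>] by auto
qed

text \<open>By Cauchy--Schwarz the even-indexed terms form a convex sequence.\<close>

lemma gram_sequence_sum_le:
  fixes z :: "nat \<Rightarrow> 'x::real_inner" and a :: "nat \<Rightarrow> real"
  assumes gram: "\<And>i j. i \<le> r \<Longrightarrow> j \<le> r \<Longrightarrow> a (i + j) = z i \<bullet> z j"
  shows "(\<Sum>q\<le>2*r. a q) \<le> (2 * real r + 1) / 2 * (a 0 + a (2 * r))"
proof -
  have cs: "2 * a (i + j) \<le> a (2 * i) + a (2 * j)" if "i \<le> r" "j \<le> r" for i j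
  proof -
    have "0 \<le> (z i - z j) \<bullet> (z i - z j)"
      by (rule inner_ge_zero)
    also have "\<dots> = z i \<bullet> z i + z j \<bullet> z j - 2 * (z i \<bullet> z j)"
      by (simp add: inner_diff_left inner_diff_right inner_commute)
    also have "\<dots> = a (2 * i) + a (2 * j) - 2 * a (i + j)"
      using gram[of i i] gram[of j j] gram[of i j] that unfolding mult_2[of i] mult_2[of j] by simp
    finally show ?thesis
      by simp
  qed
  \<comment> \<open>Adding the mirror image makes both ends equal:
    \<open>c 0 = c r = a 0 + a (2 * r)\<close>. Convexity then gives the sum of the end terms for a
    whole pair of terms.\<close>
  define c where "c i = a (2 * i) + a (2 * (r - i))" for i
  have "2 * c i \<le> c (i - 1) + c (i + 1)" if "0 < i" "i < r" for i
  proof -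
    have "(r - (i - 1)) + (r - (i + 1)) = 2 * (r - i)" "(i - 1) + (i + 1) = 2 * i"
      using that by simp_all
    moreover have "i - 1 \<le> r" "i + 1 \<le> r" "r - (i - 1) \<le> r" "r - (i + 1) \<le> r"
      using that by simp_all
    ultimately have mid: "2 * a (2 * i) \<le> a (2 * (i - 1)) + a (2 * (i + 1))"
      "2 * a (2 * (r - i)) \<le> a (2 * (r - (i - 1))) + a (2 * (r - (i + 1)))"
      using cs[of "i - 1" "i + 1"] cs[of "r - (i - 1)" "r - (i + 1)"] by metis+
    show ?thesis
      using add_mono[OF mid] by (simp only: c_def distrib_left ac_simps)
  qed
  then have c: "c i \<le> a 0 + a (2 * r)" if "i \<le> r" for i
    using convex_sequence_le_max[of r c i] that by (simp add: c_def)
  have pair: "a q + a (2 * r - q) \<le> a 0 + a (2 * r)" if q: "q \<le> 2 * r" for q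
  proof (cases "even q")
    case True
    then obtain i where "q = 2 * i" by blast
    then show ?thesis
      using c[of i] q by (simp add: c_def right_diff_distrib')
  next
    case False
    \<comment> \<open>An odd index is i + (i + 1), so by \<open>cs\<close> the pair is at most the
      mean of \<open>c i\<close> and \<open>c (i + 1)\<close>.\<close>
    then obtain i where i: "q = 2 * i + 1" using oddE by blast
    then have "i < r" using q by simp
    have "(r - i) + (r - (i + 1)) = 2 * r - q" "i + (i + 1) = q"
      using i \<open>i < r\<close> by simp_all
    then show ?thesis
      using cs[of i "i + 1"] cs[of "r - i" "r - (i + 1)"] c[of i] c[of "i + 1"] \<open>i < r\<close>
      unfolding c_def by simp
  qed
  \<comment> \<open>Reversing the order of summation pairs q with 2r - q; the 2r + 1 pairs count
    everything twice, whence the factor (2r + 1) / 2.\<close>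
  have "2 * (\<Sum>q\<le>2*r. a q) = (\<Sum>q\<le>2*r. a q) + (\<Sum>q\<le>2*r. a (2 * r - q))"
    using sum.nat_diff_reindex[of a "Suc (2 * r)"] by (simp add: lessThan_Suc_atMost)
  also have "\<dots> = (\<Sum>q\<le>2*r. a q + a (2 * r - q))"
    by (simp add: sum.distrib)
  also have "\<dots> \<le> (\<Sum>q\<le>2*r. a 0 + a (2 * r))"
    using pair by (intro sum_mono) auto
  finally show ?thesis
    by (simp add: field_simps)
qed

text \<open>A summed form of the trace inequality
  tr (H A^q H B^(2r-q)) + tr (H A^(2r-q) H B^q) <= tr (H^2 (A^2r + B^2r)), where H = A - B.\<close>

lemma inner_matrix_power_diff_le:
  fixes A B :: "real^'n::finite^'n"
  assumes A: "transpose A = A" and B: "transpose B = B"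
  shows "(A - B) \<bullet> (matrix_power A (2 * r + 1) - matrix_power B (2 * r + 1))
    \<le> (2 * real r + 1) / 2 * ((norm ((A - B) ** matrix_power A r))\<^sup>2
        + (norm ((A - B) ** matrix_power B r))\<^sup>2)"
proof -
  define H where "H = A - B"
  have H: "transpose H = H"
    using A B by (simp add: H_def transpose_def vec_eq_iff)
  define a where "a q = H \<bullet> (matrix_power A q ** H ** matrix_power B (2 * r - q))" for q
  \<comment> \<open>The even total exponent 2r is split as r + r between the two sides of the inner
    product. Moving powers across by symmetry of A and B then gives
    \<open>a (i + j) = z i \<bullet> z j\<close>.\<close>
  define z where "z i = matrix_power A i ** H ** matrix_power B (r - i)" for i
  have gram: "a (i + j) = z i \<bullet> z j" if "i \<le> r" "j \<le> r" for i j
  proof -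
    have "z i \<bullet> z j = (matrix_power A i ** H) \<bullet> (z j ** matrix_power B (r - i))"
      unfolding z_def[of i] by (simp add: inner_matrix_mult_right transpose_matrix_power B)
    also have "\<dots> = H \<bullet> (matrix_power A i ** (z j ** matrix_power B (r - i)))"
      by (simp add: inner_matrix_mult_left transpose_matrix_power A)
    also have "matrix_power A i ** (z j ** matrix_power B (r - i)) =
        matrix_power A (i + j) ** H ** matrix_power B ((r - j) + (r - i))"
      unfolding z_def matrix_power_add by (simp add: matrix_mul_assoc)
    also have "(r - j) + (r - i) = 2 * r - (i + j)"
      using that by simp
    finally show ?thesis
      by (simp add: a_def)
  qed
  have "H \<bullet> (matrix_power A (2 * r + 1) - matrix_power B (2 * r + 1)) = (\<Sum>q\<le>2*r. a q)"
    using matrix_power_diff[of A "2 * r" B]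
    by (simp add: H_def a_def inner_sum_right del: matrix_power.simps)
  also have "\<dots> \<le> (2 * real r + 1) / 2 * (a 0 + a (2 * r))"
    using gram by (rule gram_sequence_sum_le)
  also have "a 0 = (norm (H ** matrix_power B r))\<^sup>2"
    using gram[of 0 0] by (simp add: z_def power2_norm_eq_inner)
  also have "a (2 * r) = (norm (H ** matrix_power A r))\<^sup>2"
  proof -
    have "transpose (matrix_power A r ** H) = H ** matrix_power A r"
      by (simp add: matrix_transpose_mul H A transpose_matrix_power)
    then show ?thesis
      using gram[of r r] norm_transpose[of "matrix_power A r ** H"]
      by (simp add: z_def power2_norm_eq_inner[symmetric] mult_2)
  qed
  finally show ?thesis
    by (simp add: H_def add.commute)
qed

section \<open>Moments of sums of independent centred matrices\<close>

lemma norm_diff_sq_le: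
  fixes x y :: "'x::real_inner"
  shows "(norm (x - y))\<^sup>2 \<le> 2 * (norm x)\<^sup>2 + 2 * (norm y)\<^sup>2"
proof -
  have "0 \<le> (norm (x + y))\<^sup>2" by simp
  then show ?thesis
    by (simp add: power2_norm_eq_inner inner_diff_left inner_diff_right inner_add_left
        inner_add_right inner_commute)
qed

text \<open>A product of discrete distributions in terms of finite sums. The matchings take values
  in a finite type, so this describes their joint law completely.\<close>

locale finite_product_weights =
  fixes I :: "'i set" and p :: "'i \<Rightarrow> 'a::finite \<Rightarrow> real"
  assumes finite_I: "finite I"
    and nonneg: "\<And>i a. i \<in> I \<Longrightarrow> 0 \<le> p i a"
    and sum_one: "\<And>i. i \<in> I \<Longrightarrow> (\<Sum>a\<in>UNIV. p i a) = 1"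
begin

abbreviation G :: "('i \<Rightarrow> 'a) set" where "G \<equiv> PiE I (\<lambda>_. UNIV)"

definition w :: "('i \<Rightarrow> 'a) \<Rightarrow> real" where "w g = (\<Prod>i\<in>I. p i (g i))"

lemma finite_G: "finite G"
  using finite_I by (intro finite_PiE) auto

lemma w_nonneg: "0 \<le> w g"
  unfolding w_def by (intro prod_nonneg) (simp add: nonneg)

lemma w_pos_imp: "0 < w g \<Longrightarrow> i \<in> I \<Longrightarrow> 0 < p i (g i)"
proof (rule ccontr)
  assume *: "0 < w g" "i \<in> I" "\<not> 0 < p i (g i)"
  then have "p i (g i) = 0"
    using nonneg[of i "g i"] by simp
  with * have "w g = 0"
    unfolding w_def by (intro prod_zero[OF finite_I]) auto
  with * show False by simp
qed

lemma sum_w: "(\<Sum>g\<in>G. w g) = 1"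
  unfolding w_def using prod_sum_PiE[of I "\<lambda>_. UNIV" p] finite_I sum_one by simp

text \<open>The outcome \<open>g\<close> and its resampled version \<open>g(i := a)\<close> form an exchangeable pair.\<close>

lemma resample_swap:
  assumes "i \<in> I"
  shows "(\<Sum>g\<in>G. w g * (\<Sum>a\<in>UNIV. p i a * F g (g(i := a)))) =
    (\<Sum>g\<in>G. w g * (\<Sum>a\<in>UNIV. p i a * F (g(i := a)) g))"
proof -
  \<comment> \<open>Detailed balance: the involution (g, a) -> (g(i := a), g i) preserves the weight
    \<open>w g * p i a\<close>.\<close>
  have w: "w (g(i := a)) * p i (g i) = w g * p i a" for g a
  proof -
    have "(\<Prod>j\<in>I - {i}. p j ((g(i := a)) j)) = (\<Prod>j\<in>I - {i}. p j (g j))"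
      by (intro prod.cong) auto
    then show ?thesis
      unfolding w_def using prod.remove[OF finite_I assms, of "\<lambda>j. p j ((g(i := a)) j)"]
        prod.remove[OF finite_I assms, of "\<lambda>j. p j (g j)"] by simp
  qed
  have "(\<Sum>(g, a)\<in>G \<times> UNIV. w g * p i a * F g (g(i := a))) =
      (\<Sum>(g, a)\<in>G \<times> UNIV. w g * p i a * F (g(i := a)) g)"
  proof (rule sum.reindex_bij_witness[of _ "\<lambda>(g, a). (g(i := a), g i)" "\<lambda>(g, a). (g(i := a), g i)"])
    fix x :: "('i \<Rightarrow> 'a) \<times> 'a"
    assume "x \<in> G \<times> UNIV"
    then show "(case x of (g, a) \<Rightarrow> (g(i := a), g i)) \<in> G \<times> UNIV"
      using assms by (auto simp: PiE_def extensional_def)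
    then show "(case x of (g, a) \<Rightarrow> (g(i := a), g i)) \<in> G \<times> UNIV" .
    show "(case case x of (g, a) \<Rightarrow> (g(i := a), g i) of (g, a) \<Rightarrow> w g * p i a * F (g(i := a)) g) =
        (case x of (g, a) \<Rightarrow> w g * p i a * F g (g(i := a)))"
      using w by (auto split: prod.split)
  qed auto
  then show ?thesis
    by (simp add: sum.cartesian_product[symmetric] sum_distrib_left mult.assoc)
qed

text \<open>The bound \<open>q i\<close> is uniform over the values of the i-th summand, so it
  serves the drawn and the resampled value alike. It is asked only for values of positive
  probability, because other values need not be matchings.\<close>

context
  fixes X :: "'i \<Rightarrow> 'a \<Rightarrow> real^'n::finite^'n" and q :: "'i \<Rightarrow> real^'n \<Rightarrow> real" and \<sigma> :: real
  assumes sym: "\<And>i a. i \<in> I \<Longrightarrow> transpose (X i a) = X i a"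
    and mean: "\<And>i. i \<in> I \<Longrightarrow> (\<Sum>a\<in>UNIV. p i a *\<^sub>R X i a) = 0"
    and bound: "\<And>i a u. i \<in> I \<Longrightarrow> 0 < p i a \<Longrightarrow> (norm (X i a *v u))\<^sup>2 \<le> q i u"
    and total: "\<And>u. (\<Sum>i\<in>I. q i u) \<le> \<sigma> * (norm u)\<^sup>2"
    and \<sigma>: "0 \<le> \<sigma>"
begin

section \<open>Moment recursion for powers of the random sum\<close>

definition S :: "('i \<Rightarrow> 'a) \<Rightarrow> real^'n^'n" where "S g = (\<Sum>i\<in>I. X i (g i))"

lemma transpose_S: "transpose (S g) = S g"
proof -
  have "S g $ x $ y = S g $ y $ x" for x y
    unfolding S_def sum_component
    by (intro sum.cong refl) (use sym in \<open>simp add: transpose_def vec_eq_iff\<close>)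
  then show ?thesis
    by (simp add: transpose_def vec_eq_iff)
qed

text \<open>Let S' arise from S by redrawing the i-th summand. As that summand is centred,
  subtracting the redrawn copy changes nothing; exchanging the roles of S and S' and averaging gives
  half the mean of (S - S') \<bullet> (S^(2r+1) - S'^(2r+1)). The trace inequality applies to this,
  and its two error terms have equal means.\<close>

lemma moment_term:
  assumes i: "i \<in> I"
  shows "(\<Sum>g\<in>G. w g * (X i (g i) \<bullet> matrix_power (S g) (2 * r + 1))) \<le>
    2 * (2 * real r + 1) * (\<Sum>g\<in>G. w g * (\<Sum>j\<in>UNIV. q i (column j (matrix_power (S g) r))))"
proof -
  define Q where "Q g = matrix_power (S g) (2 * r + 1)" for g
  define D where "D g h = (norm ((S g - S h) ** matrix_power (S g) r))\<^sup>2" for g h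
  have S_diff: "S g - S (g(i := a)) = X i (g i) - X i a" for g a
  proof -
    have "(\<Sum>j\<in>I - {i}. X j ((g(i := a)) j)) = (\<Sum>j\<in>I - {i}. X j (g j))"
      by (intro sum.cong) auto
    then show ?thesis
      unfolding S_def using sum.remove[OF finite_I i, of "\<lambda>j. X j ((g(i := a)) j)"]
        sum.remove[OF finite_I i, of "\<lambda>j. X j (g j)"] by simp
  qed
  define T where "T = (\<Sum>g\<in>G. w g * (X i (g i) \<bullet> Q g))"
  \<comment> \<open>\<open>Q g\<close> does not depend on the redrawn value \<open>a\<close>, so by
    \<open>mean\<close> the subtracted term averages to 0.\<close>
  have T: "T = (\<Sum>g\<in>G. w g * (\<Sum>a\<in>UNIV. p i a * ((X i (g i) - X i a) \<bullet> Q g)))"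
  proof -
    have "(\<Sum>a\<in>UNIV. p i a * ((X i (g i) - X i a) \<bullet> Q g)) = X i (g i) \<bullet> Q g" for g
    proof -
      have "(\<Sum>a\<in>UNIV. p i a * ((X i (g i) - X i a) \<bullet> Q g)) =
          (\<Sum>a\<in>UNIV. p i a) * (X i (g i) \<bullet> Q g) - (\<Sum>a\<in>UNIV. p i a *\<^sub>R X i a) \<bullet> Q g"
        by (simp add: inner_diff_left right_diff_distrib sum_subtractf sum_distrib_right inner_sum_left)
      then show ?thesis
        by (simp add: mean[OF i] sum_one[OF i])
    qed
    then show ?thesis
      by (simp add: T_def)
  qed
  have T': "T = (\<Sum>g\<in>G. w g * (\<Sum>a\<in>UNIV. p i a * ((X i a - X i (g i)) \<bullet> Q (g(i := a)))))"
    using resample_swap[OF i, of "\<lambda>g h. (X i (g i) - X i (h i)) \<bullet> Q g"] T by simp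
  have D_swap: "(\<Sum>g\<in>G. w g * (\<Sum>a\<in>UNIV. p i a * D (g(i := a)) g)) =
      (\<Sum>g\<in>G. w g * (\<Sum>a\<in>UNIV. p i a * D g (g(i := a))))"
    using resample_swap[OF i, of D] by simp
  have "2 * T = (\<Sum>g\<in>G. w g * (\<Sum>a\<in>UNIV. p i a *
      ((S g - S (g(i := a))) \<bullet> (Q g - Q (g(i := a))))))"
  proof -
    have "(S g - S (g(i := a))) \<bullet> (Q g - Q (g(i := a))) =
        (X i (g i) - X i a) \<bullet> Q g + (X i a - X i (g i)) \<bullet> Q (g(i := a))" for g a
      unfolding S_diff by (simp add: inner_diff_left inner_diff_right)
    then have "(\<Sum>g\<in>G. w g * (\<Sum>a\<in>UNIV. p i a *
        ((S g - S (g(i := a))) \<bullet> (Q g - Q (g(i := a)))))) =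
      (\<Sum>g\<in>G. w g * (\<Sum>a\<in>UNIV. p i a * ((X i (g i) - X i a) \<bullet> Q g))) +
      (\<Sum>g\<in>G. w g * (\<Sum>a\<in>UNIV. p i a * ((X i a - X i (g i)) \<bullet> Q (g(i := a)))))"
      by (simp only: distrib_left sum.distrib)
    then show ?thesis
      unfolding T[symmetric] T'[symmetric] by simp
  qed
  also have "\<dots> \<le> (\<Sum>g\<in>G. w g * (\<Sum>a\<in>UNIV. p i a *
      ((2 * real r + 1) / 2 * (D g (g(i := a)) + D (g(i := a)) g))))"
  proof (intro sum_mono mult_left_mono w_nonneg nonneg i)
    fix g a
    have "norm ((S (g(i := a)) - S g) ** matrix_power (S (g(i := a))) r) =
        norm ((S g - S (g(i := a))) ** matrix_power (S (g(i := a))) r)"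
      by (metis matrix_mult_diff_right norm_minus_commute)
    then show "(S g - S (g(i := a))) \<bullet> (Q g - Q (g(i := a))) \<le>
        (2 * real r + 1) / 2 * (D g (g(i := a)) + D (g(i := a)) g)"
      unfolding Q_def D_def using inner_matrix_power_diff_le[OF transpose_S transpose_S] by metis
  qed
  also have "\<dots> = (2 * real r + 1) / 2 * ((\<Sum>g\<in>G. w g * (\<Sum>a\<in>UNIV. p i a * D g (g(i := a)))) +
      (\<Sum>g\<in>G. w g * (\<Sum>a\<in>UNIV. p i a * D (g(i := a)) g)))"
    by (simp add: sum_distrib_left sum.distrib distrib_left mult_ac)
  also have "\<dots> = (2 * real r + 1) * (\<Sum>g\<in>G. w g * (\<Sum>a\<in>UNIV. p i a * D g (g(i := a))))"
    unfolding D_swap by simp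
  \<comment> \<open>The 4 is 2 + 2 from |x - y|^2 <= 2 |x|^2 + 2 |y|^2, applied to the drawn and the
    redrawn summand. Since \<open>2 * T\<close> is being bounded, half of it remains.\<close>
  also have "\<dots> \<le> (2 * real r + 1) *
      (\<Sum>g\<in>G. w g * (4 * (\<Sum>j\<in>UNIV. q i (column j (matrix_power (S g) r)))))"
  proof (rule mult_left_mono, rule sum_mono)
    fix g
    define K where "K = (\<Sum>j\<in>UNIV. q i (column j (matrix_power (S g) r)))"
    show "w g * (\<Sum>a\<in>UNIV. p i a * D g (g(i := a))) \<le> w g * (4 * K)"
    \<comment> \<open>For weight zero \<open>bound\<close> may fail at \<open>g i\<close>, but then
      both sides vanish.\<close>
    proof (cases "0 < w g")
      case True
      have "D g (g(i := a)) \<le> 4 * K" if "0 < p i a" for a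
      proof -
        have "(norm (column j ((X i (g i) - X i a) ** matrix_power (S g) r)))\<^sup>2
            \<le> 4 * q i (column j (matrix_power (S g) r))" for j
        proof -
          let ?u = "column j (matrix_power (S g) r)"
          have "(norm ((X i (g i) - X i a) *v ?u))\<^sup>2 \<le>
              2 * (norm (X i (g i) *v ?u))\<^sup>2 + 2 * (norm (X i a *v ?u))\<^sup>2"
            unfolding matrix_vector_mult_diff_rdistrib by (rule norm_diff_sq_le)
          then show ?thesis
            using bound[OF i w_pos_imp[OF True i], of ?u] bound[OF i that, of ?u]
            by (simp add: column_matrix_mult)
        qed
        then show ?thesis
          unfolding D_def S_diff norm_matrix_columns K_def sum_distrib_left by (intro sum_mono)
      qed
      then have "(\<Sum>a\<in>UNIV. p i a * D g (g(i := a))) \<le> (\<Sum>a\<in>UNIV. p i a * (4 * K))"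
        using nonneg[OF i] by (intro sum_mono) (metis less_eq_real_def mult_left_mono mult_zero_left)
      also have "\<dots> = 4 * K"
        by (simp add: sum_distrib_right[symmetric] sum_one[OF i])
      finally show ?thesis
        using w_nonneg by (rule mult_left_mono)
    next
      case False
      then show ?thesis using w_nonneg[of g] by simp
    qed
  qed simp
  also have "(\<Sum>g\<in>G. w g * (4 * K g)) = 4 * (\<Sum>g\<in>G. w g * K g)" for K
    by (simp add: sum_distrib_left mult_ac)
  finally show ?thesis
    by (simp add: T_def Q_def algebra_simps del: matrix_power.simps)
qed

text \<open>By symmetry |S^(r+1)|^2 = S \<bullet> S^(2r+1), which is linear in the first factor and
  so splits into the terms of \<open>moment_term\<close>; \<open>total\<close>, applied to each
  column of S^r, then recombines the bounds \<open>q i\<close>.\<close>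

lemma moment_step:
  "(\<Sum>g\<in>G. w g * (norm (matrix_power (S g) (Suc r)))\<^sup>2) \<le>
    2 * (2 * real r + 1) * \<sigma> * (\<Sum>g\<in>G. w g * (norm (matrix_power (S g) r))\<^sup>2)"
proof -
  have S: "(norm (matrix_power (S g) (Suc r)))\<^sup>2 =
      (\<Sum>i\<in>I. X i (g i) \<bullet> matrix_power (S g) (2 * r + 1))" for g
  proof -
    have "(norm (matrix_power (S g) (Suc r)))\<^sup>2 =
        (S g ** matrix_power (S g) r) \<bullet> matrix_power (S g) (Suc r)"
      by (simp add: power2_norm_eq_inner)
    also have "\<dots> = S g \<bullet> (matrix_power (S g) (Suc r + r))"
      unfolding inner_matrix_mult_right matrix_power_add
      by (simp add: transpose_matrix_power transpose_S)
    also have "Suc r + r = 2 * r + 1"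
      by simp
    finally show ?thesis
      \<comment> \<open>Only the left factor is expanded into summands; the power of S stays
        intact.\<close>
      unfolding S_def[of g, THEN arg_cong, of "\<lambda>A. A \<bullet> _"] inner_sum_left .
  qed
  have "(\<Sum>g\<in>G. w g * (norm (matrix_power (S g) (Suc r)))\<^sup>2) =
      (\<Sum>i\<in>I. \<Sum>g\<in>G. w g * (X i (g i) \<bullet> matrix_power (S g) (2 * r + 1)))"
    unfolding S sum_distrib_left by (rule sum.swap)
  also have "\<dots> \<le> (\<Sum>i\<in>I. 2 * (2 * real r + 1) *
      (\<Sum>g\<in>G. w g * (\<Sum>j\<in>UNIV. q i (column j (matrix_power (S g) r)))))"
    by (intro sum_mono moment_term)
  also have "\<dots> = 2 * (2 * real r + 1) *
      (\<Sum>g\<in>G. w g * (\<Sum>i\<in>I. \<Sum>j\<in>UNIV. q i (column j (matrix_power (S g) r))))"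
    unfolding sum_distrib_left by (subst sum.swap) simp
  also have "\<dots> \<le> 2 * (2 * real r + 1) *
      (\<Sum>g\<in>G. w g * (\<sigma> * (norm (matrix_power (S g) r))\<^sup>2))"
  proof (intro mult_left_mono sum_mono w_nonneg)
    fix g
    show "(\<Sum>i\<in>I. \<Sum>j\<in>UNIV. q i (column j (matrix_power (S g) r))) \<le>
        \<sigma> * (norm (matrix_power (S g) r))\<^sup>2"
      unfolding norm_matrix_columns sum_distrib_left
      by (subst sum.swap) (intro sum_mono total)
  qed simp
  also have "\<dots> = 2 * (2 * real r + 1) * \<sigma> * (\<Sum>g\<in>G. w g * (norm (matrix_power (S g) r))\<^sup>2)"
    by (simp add: sum_distrib_left mult_ac)
  finally show ?thesis .
qed

text \<open>For r < m each step costs 2 (2r + 1) \<sigma> <= 4 m \<sigma>, so the product of odd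
  numbers is replaced by a plain power. The recursion starts at the squared norm of the identity,
  which is the dimension.\<close>

lemma moment_bound:
  "r \<le> m \<Longrightarrow> (\<Sum>g\<in>G. w g * (norm (matrix_power (S g) r))\<^sup>2) \<le> real CARD('n) * (4 * real m * \<sigma>) ^ r"
proof (induction r)
  case 0
  have "(norm (mat 1 :: real^'n^'n))\<^sup>2 = real CARD('n)"
    by (simp add: power2_norm_eq_inner inner_vec_def mat_def if_distrib cong: if_cong)
  then show ?case
    by (simp add: sum_distrib_right[symmetric] sum_w)
next
  case (Suc r)
  have "(\<Sum>g\<in>G. w g * (norm (matrix_power (S g) (Suc r)))\<^sup>2) \<le>
      2 * (2 * real r + 1) * \<sigma> * (\<Sum>g\<in>G. w g * (norm (matrix_power (S g) r))\<^sup>2)"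
    by (rule moment_step)
  also have "\<dots> \<le> (4 * real m * \<sigma>) * (real CARD('n) * (4 * real m * \<sigma>) ^ r)"
  proof (rule mult_mono)
    show "2 * (2 * real r + 1) * \<sigma> \<le> 4 * real m * \<sigma>"
      using Suc.prems \<sigma> by (intro mult_right_mono) auto
  qed (use Suc \<sigma> w_nonneg in \<open>auto intro!: sum_nonneg\<close>)
  finally show ?case
    by (simp add: mult_ac)
qed

text \<open>Markov's inequality in finite form. \<open>B\<close> may contain outcomes of weight
  zero; since they add nothing, a large eigenvalue is required only at the others.\<close>

theorem eigenvalue_tail:
  assumes B: "B \<subseteq> G"
    and bad: "\<And>g. g \<in> B \<Longrightarrow> 0 < w g \<Longrightarrow>
      \<exists>x u. u \<noteq> 0 \<and> (\<Sum>i\<in>I. X i (g i)) *v u = x *\<^sub>R u \<and> 16 * sqrt (\<sigma> * ln (2 * real CARD('n) / \<delta>)) < \<bar>x\<bar>"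
    and \<delta>: "0 < \<delta>" "\<delta> < 1" and card: "2 \<le> CARD('n)"
  shows "(\<Sum>g\<in>B. w g) \<le> \<delta>"
proof -
  define N where "N = real CARD('n)"
  define L where "L = ln (2 * N / \<delta>)"
  define t where "t = 16 * sqrt (\<sigma> * L)"
  have N: "2 \<le> N" using card by (simp add: N_def)
  \<comment> \<open>This yields L >= 1, so rounding up at most doubles L: 1 <= m <= 2 L.\<close>
  have "exp 1 \<le> 2 * N / \<delta>"
  proof -
    have "exp 1 \<le> (3::real)" by (rule exp_le)
    also have "3 * \<delta> \<le> 2 * N" using N \<delta> by linarith
    then have "3 \<le> 2 * N / \<delta>" using \<delta> by (simp add: field_simps)
    finally show ?thesis .
  qed
  then have L: "1 \<le> L"
    using \<delta> N by (simp add: L_def ln_ge_iff)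
  define m where "m = nat \<lceil>L\<rceil>"
  have m: "L \<le> real m" "real m \<le> 2 * L" "1 \<le> m"
    using L unfolding m_def by linarith+
  have t: "t\<^sup>2 = 256 * \<sigma> * L" "0 \<le> t"
    using \<sigma> L by (simp_all add: t_def power_mult_distrib)
  have fB: "finite B"
    using B finite_G finite_subset by blast
  have large: "t ^ (2 * m) < (norm (matrix_power (S g) m))\<^sup>2" if g: "g \<in> B" "0 < w g" for g
  proof -
    obtain x u where xu: "u \<noteq> 0" "S g *v u = x *\<^sub>R u" "t < \<bar>x\<bar>"
      using bad[OF g] by (auto simp: t_def L_def N_def simp flip: S_def)
    have "t ^ m < \<bar>x\<bar> ^ m"
      using xu(3) t(2) m(3) by (intro power_strict_mono) auto
    also have "\<dots> \<le> norm (matrix_power (S g) m)"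
      using eigenvalue_power_le_norm[OF xu(2,1)] .
    finally have "(t ^ m)\<^sup>2 < (norm (matrix_power (S g) m))\<^sup>2"
      using t(2) by (intro power_strict_mono) auto
    then show ?thesis
      by (simp only: power_even_eq)
  qed
  have le: "(\<Sum>g\<in>B. w g * (norm (matrix_power (S g) m))\<^sup>2) \<le> N * (4 * real m * \<sigma>) ^ m"
  proof -
    have "(\<Sum>g\<in>B. w g * (norm (matrix_power (S g) m))\<^sup>2) \<le>
        (\<Sum>g\<in>G. w g * (norm (matrix_power (S g) m))\<^sup>2)"
      using B finite_G w_nonneg by (intro sum_mono2) auto
    also have "\<dots> \<le> N * (4 * real m * \<sigma>) ^ m"
      using moment_bound[of m m] by (simp add: N_def)
    finally show ?thesis .
  qed
  show ?thesis
  proof (cases "\<sigma> = 0")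
    \<comment> \<open>Division by \<open>y\<close> is impossible here. Instead the vanishing moment
      contradicts the strict inequality \<open>large\<close> at any bad outcome of positive
      weight.\<close>
    case True
    have "w g = 0" if "g \<in> B" for g
    proof (rule ccontr)
      assume "w g \<noteq> 0"
      then have g: "0 < w g" using w_nonneg[of g] by simp
      have "0 < w g * (norm (matrix_power (S g) m))\<^sup>2"
        using large[OF that g] t(2) g by (intro mult_pos_pos) (auto intro: le_less_trans[rotated])
      also have "\<dots> \<le> (\<Sum>g\<in>B. w g * (norm (matrix_power (S g) m))\<^sup>2)"
        using w_nonneg fB that by (intro member_le_sum) auto
      also have "\<dots> \<le> 0"
        using le True m(3) by (simp add: power_0_left)
      finally show False by simp
    qed
    then show ?thesis using \<delta> by simp
  next
    case False
    then have \<sigma>': "0 < \<sigma>" using \<sigma> by simp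
    define y where "y = 4 * real m * \<sigma>"
    have y: "0 < y" using \<sigma>' m by (simp add: y_def)
    have "(\<Sum>g\<in>B. w g) * (32 * y) ^ m = (\<Sum>g\<in>B. w g * (32 * y) ^ m)"
      by (simp add: sum_distrib_right)
    also have "\<dots> \<le> (\<Sum>g\<in>B. w g * (norm (matrix_power (S g) m))\<^sup>2)"
    proof (intro sum_mono)
      fix g assume g: "g \<in> B"
      \<comment> \<open>Origin of 16: since m <= 2 L, 32 * 4 m \<sigma> <= 256 \<sigma> L =
        t^2.\<close>
      have "32 * y \<le> t\<^sup>2"
        using mult_right_mono[OF m(2), of \<sigma>] \<sigma> unfolding t y_def by (simp add: algebra_simps)
      then have "(32 * y) ^ m \<le> (t\<^sup>2) ^ m"
        using y by (intro power_mono) auto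
      then show "w g * (32 * y) ^ m \<le> w g * (norm (matrix_power (S g) m))\<^sup>2"
        using large[OF g] w_nonneg[of g]
        by (cases "0 < w g") (auto simp: power_mult intro!: mult_left_mono)
    qed
    also have "\<dots> \<le> N * y ^ m"
      using le by (simp add: y_def)
    finally have "(\<Sum>g\<in>B. w g) * 32 ^ m \<le> N"
      using y by (simp add: power_mult_distrib)
    \<comment> \<open>Any base at least e would do here, so the constant is generous; the 2 inside
      the logarithm even leaves probability \<delta> / 2.\<close>
    moreover have "2 * N / \<delta> \<le> 32 ^ m"
    proof -
      have "2 * N / \<delta> = exp L"
        using N \<delta> by (simp add: L_def)
      also have "\<dots> \<le> exp (real m)" using m by simp
      also have "\<dots> = exp 1 ^ m" by (simp flip: exp_of_nat_mult)
      also have "\<dots> \<le> 32 ^ m" using exp_le by (intro power_mono) auto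
      finally show ?thesis .
    qed
    ultimately have "(\<Sum>g\<in>B. w g) * (2 * N / \<delta>) \<le> N"
      using w_nonneg by (meson mult_left_mono order_trans sum_nonneg)
    then have "(\<Sum>g\<in>B. w g) * 2 \<le> \<delta>"
      using N \<delta> by (simp add: field_simps)
    moreover have "0 \<le> (\<Sum>g\<in>B. w g)"
      using w_nonneg by (intro sum_nonneg)
    ultimately show ?thesis by linarith
  qed
qed

end

end

section \<open>Lifts of weighted graphs\<close>

text \<open>The event is a finite disjoint union of the level sets of \<open>R\<close>, hence
  measurable for every predicate \<open>Q\<close>.\<close>

lemma (in prob_space) prob_finite_range:
  assumes "finite G" "\<And>\<omega>. \<omega> \<in> space M \<Longrightarrow> R \<omega> \<in> G"
    and "\<And>g. g \<in> G \<Longrightarrow> {\<omega> \<in> space M. R \<omega> = g} \<in> events"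
  shows "prob {\<omega> \<in> space M. Q (R \<omega>)} = (\<Sum>g | g \<in> G \<and> Q g. prob {\<omega> \<in> space M. R \<omega> = g})"
proof -
  have "{\<omega> \<in> space M. Q (R \<omega>)} = (\<Union>g\<in>{g\<in>G. Q g}. {\<omega> \<in> space M. R \<omega> = g})"
    using assms(2) by auto
  then show ?thesis
    using assms(1,3)
    by (simp, intro finite_measure_finite_Union) (auto simp: disjoint_family_on_def)
qed

text \<open>Weights sit on unordered edges, which makes the matrix symmetric by
  construction.\<close>

definition weighted_adj :: "'v::finite set set \<Rightarrow> ('v set \<Rightarrow> real) \<Rightarrow> real^'v^'v" where
  "weighted_adj E c = (\<chi> v w. if {v, w} \<in> E then c {v, w} else 0)"

text \<open>The matrix c_e (P_e - J/k) with both of its blocks, extended by zero to all fibres. It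
  makes sense for every set \<open>m\<close>, so it can be applied to each possible value of the
  random variable.\<close>

definition edge_deviation ::
    "('v set \<Rightarrow> real) \<Rightarrow> 'v::finite set \<Rightarrow> ('v \<times> 'k::finite) set set \<Rightarrow> real^('v \<times> 'k)^('v \<times> 'k)" where
  "edge_deviation c e m = (\<chi> x y. if {fst x, fst y} = e
     then c e * (of_bool ({x, y} \<in> m) - 1 / real CARD('k)) else 0)"

definition fibre_sum :: "real^('v::finite \<times> 'k::finite) \<Rightarrow> real^'v" where
  "fibre_sum u = (\<chi> v. \<Sum>l\<in>UNIV. u $ (v, l))"

section \<open>Norm bounds for the deviation of a single edge\<close>

lemma sum_UNIV_prod:
  "(\<Sum>x\<in>UNIV. f x) = (\<Sum>v\<in>UNIV. \<Sum>l\<in>UNIV. f (v :: 'a::finite, l :: 'b::finite))"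
  using sum.cartesian_product'[of f UNIV UNIV] by simp

lemma transpose_edge_deviation: "transpose (edge_deviation c e m) = edge_deviation c e m"
  by (simp add: transpose_def edge_deviation_def insert_commute vec_eq_iff)

lemma linear_fibre_sum: "linear fibre_sum"
  by (intro linearI) (simp_all add: fibre_sum_def vec_eq_iff sum.distrib sum_distrib_left)

lemma perfect_matching_ex1:
  assumes m: "perfect_matching_between (fibre v) (fibre w) m" and "v \<noteq> w"
  shows "\<exists>!r. {(v, l), (w, r)} \<in> m" "\<exists>!l. {(v, l), (w, r)} \<in> m"
proof -
  have edge: "\<exists>l r. e = {(v, l), (w, r)}" if "e \<in> m" for e
  proof -
    have "\<exists>x\<in>fibre v. \<exists>y\<in>fibre w. e = {x, y}"
      using m that by (simp add: perfect_matching_between_def)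
    then show ?thesis
      by (auto simp: fibre_def)
  qed
  have ex1: "\<exists>!e. e \<in> m \<and> z \<in> e" if "z \<in> fibre v \<union> fibre w" for z
    using m that by (simp add: perfect_matching_between_def)
  have uniq: "e = e'" if "z \<in> fibre v \<union> fibre w" "e \<in> m" "z \<in> e" "e' \<in> m" "z \<in> e'" for z e e'
    using ex1[OF that(1)] that(2-5) by (elim ex1E) metis
  have in_fibres: "(v, l) \<in> fibre v \<union> fibre w" "(w, r) \<in> fibre v \<union> fibre w"
    by (auto simp: fibre_def)
  note ex = in_fibres[THEN ex1, THEN ex1_implies_ex]
  show "\<exists>!r. {(v, l), (w, r)} \<in> m"
  proof (rule ex_ex1I)
    obtain e where e: "e \<in> m" "(v, l) \<in> e"
      using ex(1) by blast
    with edge[OF e(1)] \<open>v \<noteq> w\<close> show "\<exists>r. {(v, l), (w, r)} \<in> m" by auto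
    fix r r' assume "{(v, l), (w, r)} \<in> m" "{(v, l), (w, r')} \<in> m"
    then have "{(v, l), (w, r)} = {(v, l), (w, r')}"
      using uniq[OF in_fibres(1)] by simp
    then show "r = r'" by (auto simp: doubleton_eq_iff)
  qed
  show "\<exists>!l. {(v, l), (w, r)} \<in> m"
  proof (rule ex_ex1I)
    obtain e where e: "e \<in> m" "(w, r) \<in> e"
      using ex(2) by blast
    with edge[OF e(1)] \<open>v \<noteq> w\<close> show "\<exists>l. {(v, l), (w, r)} \<in> m" by auto
    fix l l' assume "{(v, l), (w, r)} \<in> m" "{(v, l'), (w, r)} \<in> m"
    then have "{(v, l), (w, r)} = {(v, l'), (w, r)}"
      using uniq[OF in_fibres(2)] by simp
    then show "l = l'" by (auto simp: doubleton_eq_iff)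
  qed
qed

text \<open>The permutation behind P_e; its bijectivity allows sums of squares over a fibre to be
  reindexed.\<close>

lemma perfect_matching_bij:
  assumes m: "perfect_matching_between (fibre v) (fibre w) m" and "v \<noteq> w"
  obtains \<pi> where "bij \<pi>" "\<And>l r. {(v, l), (w, r)} \<in> m \<longleftrightarrow> r = \<pi> l"
proof -
  have "\<exists>r. \<forall>r'. {(v, l), (w, r')} \<in> m \<longleftrightarrow> r' = r" for l
    using perfect_matching_ex1(1)[OF assms, of l] by (elim ex1E) blast
  then obtain \<pi> where \<pi>: "\<And>l r. {(v, l), (w, r)} \<in> m \<longleftrightarrow> r = \<pi> l"
    by metis
  have "\<exists>!l. \<pi> l = r" for r
    using perfect_matching_ex1(2)[OF assms, of r] unfolding \<pi> eq_commute[of r] .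
  then have "bij \<pi>"
    by (simp add: bij_iff)
  then show ?thesis
    using that \<pi> by blast
qed

text \<open>Variance is at most the second moment: I - J/k is a contraction.\<close>

lemma sum_sq_deviation_le:
  fixes f :: "'k::finite \<Rightarrow> real"
  shows "(\<Sum>r\<in>UNIV. (f r - (\<Sum>r\<in>UNIV. f r) / real CARD('k))\<^sup>2) \<le> (\<Sum>r\<in>UNIV. (f r)\<^sup>2)"
proof -
  define a where "a = (\<Sum>r\<in>UNIV. f r) / real CARD('k)"
  have a: "(\<Sum>r\<in>UNIV. f r) = real CARD('k) * a"
    by (simp add: a_def)
  have "(\<Sum>r\<in>UNIV. (f r - a)\<^sup>2) = (\<Sum>r\<in>UNIV. (f r)\<^sup>2) - 2 * a * (\<Sum>r\<in>UNIV. f r) + real CARD('k) * a\<^sup>2"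
    by (simp add: power2_diff sum.distrib sum_subtractf sum_distrib_left sum_distrib_right mult_ac)
  also have "\<dots> = (\<Sum>r\<in>UNIV. (f r)\<^sup>2) - real CARD('k) * a\<^sup>2"
    unfolding a by (simp add: power2_eq_square)
  finally show ?thesis
    by (simp add: a_def)
qed

text \<open>On the fibre over w the block first subtracts the mean and then permutes; neither
  increases the sum of squares.\<close>

lemma edge_deviation_row_sq_le:
  fixes u :: "real^('v::finite \<times> 'k::finite)"
  assumes m: "perfect_matching_between (fibre v) (fibre w) m" and "v \<noteq> w"
  shows "(\<Sum>l\<in>UNIV. ((edge_deviation c {v, w} m *v u) $ (v, l))\<^sup>2)
    \<le> (c {v, w})\<^sup>2 * (\<Sum>r\<in>UNIV. (u $ (w, r))\<^sup>2)"
proof -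
  obtain \<pi> where \<pi>: "bij \<pi>" "\<And>l r. {(v, l), (w, r)} \<in> m \<longleftrightarrow> r = \<pi> l"
    using perfect_matching_bij[OF assms] by blast
  define a where "a = (\<Sum>r\<in>UNIV. u $ (w, r)) / real CARD('k)"
  have row: "(edge_deviation c {v, w} m *v u) $ (v, l) = c {v, w} * (u $ (w, \<pi> l) - a)" for l
  proof -
    have "(edge_deviation c {v, w} m *v u) $ (v, l) = (\<Sum>w'\<in>UNIV. if w' = w then
        (\<Sum>r\<in>UNIV. c {v, w} * (of_bool (r = \<pi> l) - 1 / real CARD('k)) * u $ (w, r)) else 0)"
      unfolding matrix_vector_mult_def vec_lambda_beta sum_UNIV_prod
      by (intro sum.cong refl) (use \<open>v \<noteq> w\<close> in \<open>auto simp: edge_deviation_def \<pi>(2) doubleton_eq_iff\<close>)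
    also have "\<dots> = (\<Sum>r\<in>UNIV. c {v, w} *
        ((if r = \<pi> l then u $ (w, r) else 0) - 1 / real CARD('k) * u $ (w, r)))"
      by simp (intro sum.cong refl, auto simp: algebra_simps)
    also have "\<dots> = c {v, w} * (u $ (w, \<pi> l) - a)"
      unfolding sum_distrib_left[symmetric] sum_subtractf by (simp add: a_def sum_distrib_left[symmetric])
    finally show ?thesis .
  qed
  have "(\<Sum>l\<in>UNIV. ((edge_deviation c {v, w} m *v u) $ (v, l))\<^sup>2) =
      (c {v, w})\<^sup>2 * (\<Sum>l\<in>UNIV. (u $ (w, \<pi> l) - a)\<^sup>2)"
    by (simp add: row power_mult_distrib sum_distrib_left)
  also have "(\<Sum>l\<in>UNIV. (u $ (w, \<pi> l) - a)\<^sup>2) = (\<Sum>r\<in>UNIV. (u $ (w, r) - a)\<^sup>2)"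
    using sum.reindex_bij_betw[OF \<pi>(1), of "\<lambda>r. (u $ (w, r) - a)\<^sup>2"] .
  also have "\<dots> \<le> (\<Sum>r\<in>UNIV. (u $ (w, r))\<^sup>2)"
    unfolding a_def by (rule sum_sq_deviation_le)
  finally show ?thesis
    by (simp add: mult_left_mono)
qed

text \<open>The two blocks write to disjoint fibres, so their squares add without cross terms. The
  right side is free of \<open>m\<close>, as needed for a bound uniform over the matchings.\<close>

lemma edge_deviation_norm_sq_le:
  fixes u :: "real^('v::finite \<times> 'k::finite)"
  assumes m: "perfect_matching_between (fibre v) (fibre w) m"
      "perfect_matching_between (fibre w) (fibre v) m" and vw: "v \<noteq> w"
  shows "(norm (edge_deviation c {v, w} m *v u))\<^sup>2
    \<le> (c {v, w})\<^sup>2 * (\<Sum>x | fst x \<in> {v, w}. (u $ x)\<^sup>2)"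
proof -
  let ?y = "edge_deviation c {v, w} m *v u"
  have fib: "(\<Sum>x | fst x \<in> {v, w}. f x) = (\<Sum>l\<in>UNIV. f (v, l)) + (\<Sum>l\<in>UNIV. f (w, l))"
    for f :: "'v \<times> 'k \<Rightarrow> real"
  proof -
    have "{x :: 'v \<times> 'k. fst x \<in> {v, w}} = {v, w} \<times> UNIV" by auto
    then show ?thesis
      using vw by (simp only: sum.cartesian_product') simp
  qed
  have "?y $ x = 0" if "fst x \<notin> {v, w}" for x
  proof -
    have "{fst x, z} \<noteq> {v, w}" for z using that by auto
    then show ?thesis
      by (simp add: matrix_vector_mult_def edge_deviation_def)
  qed
  then have "(norm ?y)\<^sup>2 = (\<Sum>x | fst x \<in> {v, w}. (?y $ x)\<^sup>2)"
    unfolding power2_norm_eq_inner inner_vec_def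
    by (intro sum.mono_neutral_cong_right) (auto simp: power2_eq_square)
  also have "\<dots> \<le> (c {v, w})\<^sup>2 * (\<Sum>l\<in>UNIV. (u $ (w, l))\<^sup>2) + (c {v, w})\<^sup>2 * (\<Sum>l\<in>UNIV. (u $ (v, l))\<^sup>2)"
    unfolding fib using edge_deviation_row_sq_le[OF m(1) vw, of c u]
      edge_deviation_row_sq_le[OF m(2) vw[symmetric], of c u]
    by (simp add: insert_commute)
  finally show ?thesis
    by (simp add: fib distrib_left add.commute del: insert_iff)
qed

section \<open>Deterministic facts about a single lift\<close>

locale lift_of_graph =
  fixes E :: "'v::finite set set" and m :: "'v set \<Rightarrow> ('v \<times> 'k::finite) set set"
  assumes simple: "simple_graph E" and matchings: "lift_matchings E m"
begin

lemma edge_distinct: "{v, w} \<in> E \<Longrightarrow> v \<noteq> w"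
  using simple by (fastforce simp: simple_graph_def)

lemma edge_obtain:
  assumes "e \<in> E"
  obtains v w where "e = {v, w}" "v \<noteq> w"
  using simple assms by (auto simp: simple_graph_def card_2_iff)

lemma matching: "{v, w} \<in> E \<Longrightarrow> perfect_matching_between (fibre v) (fibre w) (m {v, w})"
  using matchings by (simp add: lift_matchings_def)

lemma matching_edge_ends:
  assumes "e \<in> E" "{x, y} \<in> m e"
  shows "{fst x, fst y} = e"
proof -
  obtain v w where vw: "e = {v, w}" "v \<noteq> w"
    using edge_obtain[OF assms(1)] .
  then have "\<exists>a\<in>fibre v. \<exists>b\<in>fibre w. {x, y} = {a, b}"
    using matching[of v w] assms unfolding perfect_matching_between_def by blast
  then show ?thesis
    using vw by (auto simp: fibre_def doubleton_eq_iff)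
qed

text \<open>Every edge of \<open>m e\<close> projects onto \<open>e\<close>, so the matchings of
  different base edges do not interfere.\<close>

lemma lift_edges_iff: "{x, y} \<in> lift_edges E m \<longleftrightarrow> {fst x, fst y} \<in> E \<and> {x, y} \<in> m {fst x, fst y}"
  using matching_edge_ends unfolding lift_edges_def by blast

lemma sum_matching:
  assumes "{v, w} \<in> E"
  shows "(\<Sum>l\<in>UNIV. of_bool ({(v, l), (w, r)} \<in> m {v, w})) = (1::real)"
proof -
  obtain l where "\<And>l'. {(v, l'), (w, r)} \<in> m {v, w} \<longleftrightarrow> l' = l"
    using perfect_matching_ex1(2)[OF matching edge_distinct, OF assms assms, of r] by blast
  then show ?thesis
    by (simp add: of_bool_def)
qed

text \<open>The projection \<open>fst\<close> is a covering map: each base edge at v has exactly one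
  lift at (v, l).\<close>

lemma vdegree_lift: "vdegree (lift_edges E m) (v, l) = vdegree E v"
proof -
  have "bij_betw fst {x. {(v, l), x} \<in> lift_edges E m} {w. {v, w} \<in> E}"
    unfolding bij_betw_def
  proof
    have "x = y" if "{(v, l), x} \<in> lift_edges E m" "{(v, l), y} \<in> lift_edges E m" "fst x = fst y" for x y
      using perfect_matching_ex1(1)[OF matching edge_distinct, of v "fst x" l] that
      by (cases x; cases y) (auto simp: lift_edges_iff)
    then show "inj_on fst {x. {(v, l), x} \<in> lift_edges E m}"
      by (auto intro!: inj_onI)
    show "fst ` {x. {(v, l), x} \<in> lift_edges E m} = {w. {v, w} \<in> E}"
    proof (intro equalityI subsetI)
      fix w assume "w \<in> {w. {v, w} \<in> E}"
      then have w: "{v, w} \<in> E" by simp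
      then obtain r where "{(v, l), (w, r)} \<in> m {v, w}"
        using perfect_matching_ex1(1)[OF matching edge_distinct, of v w l] by blast
      with w have "(w, r) \<in> {x. {(v, l), x} \<in> lift_edges E m}"
        by (simp add: lift_edges_iff)
      then show "w \<in> fst ` {x. {(v, l), x} \<in> lift_edges E m}"
        by (metis fst_conv imageI)
    qed (auto simp: lift_edges_iff)
  qed
  then show ?thesis
    unfolding vdegree_def by (rule bij_betw_same_card)
qed

context
  fixes c :: "'v set \<Rightarrow> real"
begin

definition lifted :: "real^('v \<times> 'k)^('v \<times> 'k)" where
  "lifted = weighted_adj (lift_edges E m) (\<lambda>e. c (fst ` e))"

text \<open>The columns of each P_e sum to 1, so summation over fibres intertwines the lift with the
  base.\<close>

lemma fibre_sum_lifted: "fibre_sum (lifted *v u) = weighted_adj E c *v fibre_sum u"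
proof -
  have "(\<Sum>l\<in>UNIV. \<Sum>w\<in>UNIV. \<Sum>r\<in>UNIV. lifted $ (v, l) $ (w, r) * u $ (w, r)) =
      (\<Sum>w\<in>UNIV. weighted_adj E c $ v $ w * (\<Sum>r\<in>UNIV. u $ (w, r)))" for v
  proof -
    have "(\<Sum>l\<in>UNIV. lifted $ (v, l) $ (w, r)) = weighted_adj E c $ v $ w" for w r
    proof -
      have "(\<Sum>l\<in>UNIV. lifted $ (v, l) $ (w, r)) =
          (\<Sum>l\<in>UNIV. weighted_adj E c $ v $ w * of_bool ({(v, l), (w, r)} \<in> m {v, w}))"
        by (intro sum.cong) (simp_all add: lifted_def weighted_adj_def lift_edges_iff)
      also have "\<dots> = weighted_adj E c $ v $ w"
        using sum_matching[of v w r]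
        by (cases "{v, w} \<in> E") (simp_all add: weighted_adj_def sum_distrib_left[symmetric] del: sum_of_bool_eq)
      finally show ?thesis .
    qed
    moreover have "(\<Sum>l\<in>UNIV. \<Sum>w\<in>UNIV. \<Sum>r\<in>UNIV. lifted $ (v, l) $ (w, r) * u $ (w, r)) =
        (\<Sum>w\<in>UNIV. \<Sum>r\<in>UNIV. \<Sum>l\<in>UNIV. lifted $ (v, l) $ (w, r) * u $ (w, r))"
      by (subst sum.swap) (intro sum.cong refl sum.swap)
    ultimately show ?thesis
      by (simp add: sum_distrib_right[symmetric] sum_distrib_left[symmetric])
  qed
  then show ?thesis
    by (simp add: fibre_sum_def matrix_vector_mult_def vec_eq_iff sum_UNIV_prod)
qed

text \<open>The blocks J/k see a vector only through its fibre sums, so subtracting them is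
  invisible here.\<close>

lemma lifted_eq_deviation:
  assumes "fibre_sum u = 0"
  shows "lifted *v u = (\<Sum>e\<in>E. edge_deviation c e (m e)) *v u"
proof -
  have dev: "(\<Sum>e\<in>E. edge_deviation c e (m e)) $ x $ y =
      lifted $ x $ y - weighted_adj E c $ fst x $ fst y / real CARD('k)" for x y
  proof -
    have "(\<Sum>e\<in>E. edge_deviation c e (m e)) $ x $ y = (\<Sum>e\<in>E. if {fst x, fst y} = e
        then c e * (of_bool ({x, y} \<in> m e) - 1 / real CARD('k)) else 0)"
      by (simp add: edge_deviation_def)
    then show ?thesis
      by (simp add: lifted_def weighted_adj_def lift_edges_iff right_diff_distrib)
  qed
  have "(\<Sum>y\<in>UNIV. weighted_adj E c $ fst x $ fst y / real CARD('k) * u $ y) = 0" for x :: "'v \<times> 'k"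
  proof -
    have "(\<Sum>y\<in>UNIV. weighted_adj E c $ fst x $ fst y / real CARD('k) * u $ y) =
        (\<Sum>w\<in>UNIV. weighted_adj E c $ fst x $ w / real CARD('k) * fibre_sum u $ w)"
      by (simp add: sum_UNIV_prod fibre_sum_def sum_distrib_left)
    then show ?thesis
      by (simp add: assms)
  qed
  then show ?thesis
    by (simp add: matrix_vector_mult_def vec_eq_iff dev left_diff_distrib sum_subtractf
        del: sum_component)
qed

text \<open>By the intertwining, \<open>fibre_sum\<close> maps the eigenspace of the lift into that
  of the base. A drop in dimension forces a kernel vector, which handles multiplicities without any
  orthogonal decomposition.\<close>

lemma new_eigenvector:
  assumes "dim (eigenspace (weighted_adj E c) x) < dim (eigenspace lifted x)"
  shows "\<exists>u. u \<noteq> 0 \<and> (\<Sum>e\<in>E. edge_deviation c e (m e)) *v u = x *\<^sub>R u"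
proof -
  let ?S = "eigenspace lifted x"
  have sub: "subspace ?S"
    by (auto simp: subspace_def eigenspace_def matrix_vector_right_distrib scaleR_add_right
        matrix_vector_mult_scaleR)
  have "\<exists>u\<in>?S. u \<noteq> 0 \<and> fibre_sum u = 0"
  proof (rule ccontr)
    assume *: "\<not> ?thesis"
    have "inj_on fibre_sum ?S"
      using * linear_injective_on_subspace_0[OF linear_fibre_sum sub] by blast
    then have "dim ?S = dim (fibre_sum ` ?S)"
      using sub linear_fibre_sum by (metis dim_image_eq span_eq_iff)
    also have "\<dots> \<le> dim (eigenspace (weighted_adj E c) x)"
      by (intro dim_subset)
        (auto simp: eigenspace_def linear_cmul[OF linear_fibre_sum] simp flip: fibre_sum_lifted)
    finally show False
      using assms by simp
  qed
  then show ?thesis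
    using lifted_eq_deviation by (auto simp: eigenspace_def)
qed

end

end

section \<open>New eigenvalues of random lifts\<close>

lemma sum_edges_at:
  fixes E :: "'v::finite set set"
  assumes "simple_graph E"
  shows "(\<Sum>e | e \<in> E \<and> v \<in> e. f e) = (\<Sum>w | {v, w} \<in> E. f {v, w})"
proof (rule sum.reindex_bij_betw[symmetric])
  have "\<exists>w. e = {v, w}" if "e \<in> E" "v \<in> e" for e
    using assms that by (auto simp: simple_graph_def card_2_iff)
  then show "bij_betw (\<lambda>w. {v, w}) {w. {v, w} \<in> E} {e. e \<in> E \<and> v \<in> e}"
    by (fastforce simp: bij_betw_def inj_on_def doubleton_eq_iff)
qed

text \<open>Double counting: the coordinate at x is charged exactly by the edges at
  \<open>fst x\<close>.\<close>

lemma sum_edge_weights_le: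
  fixes u :: "real^('v::finite \<times> 'k::finite)"
  assumes "\<And>v. (\<Sum>e | e \<in> E \<and> v \<in> e. (c e)\<^sup>2) \<le> \<sigma>"
  shows "(\<Sum>e\<in>E. (c e)\<^sup>2 * (\<Sum>x | fst x \<in> e. (u $ x)\<^sup>2)) \<le> \<sigma> * (norm u)\<^sup>2"
proof -
  have "(\<Sum>e\<in>E. (c e)\<^sup>2 * (\<Sum>x | fst x \<in> e. (u $ x)\<^sup>2)) =
      (\<Sum>e\<in>E. \<Sum>x\<in>UNIV. if fst x \<in> e then (c e)\<^sup>2 * (u $ x)\<^sup>2 else 0)"
    unfolding sum_distrib_left by (intro sum.cong refl sum.mono_neutral_cong_left) auto
  also have "\<dots> = (\<Sum>x\<in>UNIV. \<Sum>e\<in>E. if fst x \<in> e then (c e)\<^sup>2 * (u $ x)\<^sup>2 else 0)"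
    by (rule sum.swap)
  also have "\<dots> = (\<Sum>x\<in>UNIV. (\<Sum>e | e \<in> E \<and> fst x \<in> e. (c e)\<^sup>2) * (u $ x)\<^sup>2)"
    unfolding sum_distrib_right by (intro sum.cong refl sum.mono_neutral_cong_right) auto
  also have "\<dots> \<le> (\<Sum>x\<in>UNIV. \<sigma> * (u $ x)\<^sup>2)"
    by (intro sum_mono mult_right_mono assms) auto
  also have "\<dots> = \<sigma> * (norm u)\<^sup>2"
    unfolding power2_norm_eq_inner inner_vec_def by (simp add: power2_eq_square sum_distrib_left)
  finally show ?thesis .
qed

text \<open>One tail bound for both claims, stated through eigenspace dimensions. It is used with
  \<sigma> = \<Delta> for unit weights and \<sigma> = 1/d for the normalized ones.\<close>

theorem new_eigenvalue_tail:
  fixes E :: "'v::finite set set" and \<Omega> :: "'w measure"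
    and M :: "'v set \<Rightarrow> 'w \<Rightarrow> ('v \<times> 'k::finite) set set"
    and c :: "'v set \<Rightarrow> real"
  assumes simple: "simple_graph E" and k: "2 \<le> CARD('k)" and "prob_space \<Omega>"
    and match: "\<And>\<omega>. \<omega> \<in> space \<Omega> \<Longrightarrow> lift_matchings E (\<lambda>e. M e \<omega>)"
    and indep: "prob_space.indep_vars \<Omega> (\<lambda>_. count_space UNIV) M E"
    and unif: "\<And>v w l r. {v, w} \<in> E \<Longrightarrow>
      measure \<Omega> {\<omega> \<in> space \<Omega>. {(v, l), (w, r)} \<in> M {v, w} \<omega>} = 1 / real CARD('k)"
    and \<delta>: "0 < \<delta>" "\<delta> < 1"
    and weights: "\<And>v. (\<Sum>e | e \<in> E \<and> v \<in> e. (c e)\<^sup>2) \<le> \<sigma>"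
  shows "1 - \<delta> \<le> measure \<Omega> {\<omega> \<in> space \<Omega>. \<forall>x. dim (eigenspace (weighted_adj E c) x) <
      dim (eigenspace (weighted_adj (lift_edges E (\<lambda>e. M e \<omega>)) (\<lambda>e. c (fst ` e))) x) \<longrightarrow>
      \<bar>x\<bar> \<le> 16 * sqrt (\<sigma> * ln (2 * real CARD('v) * real CARD('k) / \<delta>))}"
proof -
  interpret prob_space \<Omega> by fact
  define p where "p e a = prob {\<omega> \<in> space \<Omega>. M e \<omega> = a}" for e a
  have ev: "{\<omega> \<in> space \<Omega>. M e \<omega> = a} \<in> events" if "e \<in> E" for e a
  proof -
    have "M e \<in> measurable \<Omega> (count_space UNIV)"
      using indep that by (simp add: indep_vars_def)
    from measurable_sets[OF this, of "{a}"] show ?thesis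
      by (simp add: vimage_def Int_def conj_commute)
  qed
  have prob_edge: "prob {\<omega> \<in> space \<Omega>. Q (M e \<omega>)} = (\<Sum>a | Q a. p e a)" if "e \<in> E" for e Q
    using prob_finite_range[of UNIV "M e" Q] ev[OF that] by (simp add: p_def)
  interpret W: finite_product_weights E p
  proof
    show "(\<Sum>a\<in>UNIV. p e a) = 1" if "e \<in> E" for e
      using prob_edge[OF that, of "\<lambda>_. True"] by (simp add: prob_space)
  qed (simp_all add: p_def)
  \<comment> \<open>Outside \<open>E\<close> the variables are unconstrained, so an outcome records
    only the matchings of actual edges.\<close>
  define R where "R \<omega> = restrict (\<lambda>e. M e \<omega>) E" for \<omega>
  have R_mem: "R \<omega> \<in> W.G" for \<omega>
    by (simp add: R_def)
  have R_eq: "{\<omega> \<in> space \<Omega>. R \<omega> = g} = {\<omega> \<in> space \<Omega>. \<forall>e\<in>E. M e \<omega> = g e}" if "g \<in> W.G" for g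
    using that by (auto simp: R_def fun_eq_iff restrict_def PiE_def extensional_def)
  have R_ev: "{\<omega> \<in> space \<Omega>. R \<omega> = g} \<in> events" if "g \<in> W.G" for g
    unfolding R_eq[OF that] using ev by (intro sets.sets_Collect_finite_All) auto
  have R_prob: "prob {\<omega> \<in> space \<Omega>. R \<omega> = g} = W.w g" if "g \<in> W.G" for g
  \<comment> \<open>The product formula for independent variables requires a nonempty index set;
    without edges both sides are 1.\<close>
  proof (cases "E = {}")
    case True
    then show ?thesis
      unfolding R_eq[OF that] W.w_def by (simp add: prob_space)
  next
    case False
    have "(\<Inter>e\<in>E. M e -` {g e} \<inter> space \<Omega>) = {\<omega> \<in> space \<Omega>. \<forall>e\<in>E. M e \<omega> = g e}"
      using False by auto
    moreover have "M e -` {g e} \<inter> space \<Omega> = {\<omega> \<in> space \<Omega>. M e \<omega> = g e}" for e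
      by auto
    ultimately show ?thesis
      using indep_varsD_finite[OF indep False, of "\<lambda>e. {g e}"]
      by (simp add: R_eq[OF that] W.w_def p_def)
  qed
  \<comment> \<open>A value of positive probability is attained at some point of the space, where
    the matching hypothesis applies.\<close>
  have support: "perfect_matching_between (fibre v) (fibre w) a"
    if "{v, w} \<in> E" "0 < p {v, w} a" for v w a
  proof -
    have "{\<omega> \<in> space \<Omega>. M {v, w} \<omega> = a} \<noteq> {}"
      using that(2) unfolding p_def by (metis less_irrefl measure_empty)
    then obtain \<omega> where \<omega>: "\<omega> \<in> space \<Omega>" "M {v, w} \<omega> = a" by blast
    then show ?thesis
      using match[OF \<omega>(1), unfolded lift_matchings_def, rule_format, OF that(1)] by simp
  qed
  have lift: "lift_of_graph E g" if "g \<in> W.G" "0 < W.w g" for g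
    using simple support W.w_pos_imp[OF that(2)] by unfold_locales (simp_all add: lift_matchings_def)
  let ?bound = "16 * sqrt (\<sigma> * ln (2 * real CARD('v \<times> 'k) / \<delta>))"
  define good where "good m \<longleftrightarrow> (\<forall>x. dim (eigenspace (weighted_adj E c) x) <
      dim (eigenspace (weighted_adj (lift_edges E m) (\<lambda>e. c (fst ` e))) x) \<longrightarrow> \<bar>x\<bar> \<le> ?bound)"
    for m :: "'v set \<Rightarrow> ('v \<times> 'k) set set"
  define q where "q e u = (c e)\<^sup>2 * (\<Sum>x | fst x \<in> e. (u $ x)\<^sup>2)" for e and u :: "real^('v \<times> 'k)"
  \<comment> \<open>The uniform marginals say precisely that P_e has mean J/k.\<close>
  have mean: "(\<Sum>a\<in>UNIV. p e a *\<^sub>R edge_deviation c e a) = 0" if "e \<in> E" for e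
  proof -
    have centred: "(\<Sum>a\<in>UNIV. p e a * (of_bool ({x, y} \<in> a) - 1 / real CARD('k))) = 0"
      if xy: "{fst x, fst y} = e" for x y :: "'v \<times> 'k"
    proof -
      have "(\<Sum>a\<in>UNIV. p e a * of_bool ({x, y} \<in> a)) = (\<Sum>a | {x, y} \<in> a. p e a)"
        by (intro sum.mono_neutral_cong_right) auto
      also have "\<dots> = 1 / real CARD('k)"
        using prob_edge[OF \<open>e \<in> E\<close>, of "\<lambda>a. {x, y} \<in> a"] unif[of "fst x" "fst y" "snd x" "snd y"]
          \<open>e \<in> E\<close> xy by simp
      finally show ?thesis
        using W.sum_one[OF \<open>e \<in> E\<close>]
        by (simp add: right_diff_distrib sum_subtractf sum_divide_distrib[symmetric])
    qed
    have "(\<Sum>a\<in>UNIV. p e a *\<^sub>R edge_deviation c e a) $ x $ y = 0" for x y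
    proof (cases "{fst x, fst y} = e")
      case True
      have "(\<Sum>a\<in>UNIV. p e a *\<^sub>R edge_deviation c e a) $ x $ y =
          c e * (\<Sum>a\<in>UNIV. p e a * (of_bool ({x, y} \<in> a) - 1 / real CARD('k)))"
        by (simp add: edge_deviation_def True sum_distrib_left mult.left_commute)
      then show ?thesis
        using centred[OF True] by simp
    qed (simp add: edge_deviation_def)
    then show ?thesis
      by (simp add: vec_eq_iff del: sum_component)
  qed
  have "(\<Sum>g | g \<in> W.G \<and> \<not> good g. W.w g) \<le> \<delta>"
  proof (rule W.eigenvalue_tail[of "edge_deviation c" q \<sigma>])
    show "(norm (edge_deviation c e a *v u))\<^sup>2 \<le> q e u" if e: "e \<in> E" "0 < p e a" for e a u
    proof -
      obtain v w where vw: "e = {v, w}" "v \<noteq> w"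
        using simple e(1) by (auto simp: simple_graph_def card_2_iff)
      have "{w, v} = e" using vw(1) by (simp add: insert_commute)
      then have "perfect_matching_between (fibre v) (fibre w) a"
          "perfect_matching_between (fibre w) (fibre v) a"
        using support[of v w a] support[of w v a] e vw(1) by simp_all
      then show ?thesis
        unfolding q_def vw(1) by (rule edge_deviation_norm_sq_le[OF _ _ vw(2)])
    qed
    show "(\<Sum>e\<in>E. q e u) \<le> \<sigma> * (norm u)\<^sup>2" for u
      unfolding q_def by (rule sum_edge_weights_le[OF weights])
    \<comment> \<open>Any vertex will do, as the type of vertices is nonempty.\<close>
    show "0 \<le> \<sigma>"
      using weights[of undefined] by (rule order_trans[rotated]) (simp add: sum_nonneg)
    have "1 \<le> CARD('v)"
      by (simp add: Suc_le_eq)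
    then show "2 \<le> CARD('v \<times> 'k)"
      using mult_le_mono[OF _ k, of 1 "CARD('v)"] by simp
    show "\<exists>x u. u \<noteq> 0 \<and> (\<Sum>e\<in>E. edge_deviation c e (g e)) *v u = x *\<^sub>R u \<and> ?bound < \<bar>x\<bar>"
      if g: "g \<in> {g. g \<in> W.G \<and> \<not> good g}" "0 < W.w g" for g
    proof -
      interpret L: lift_of_graph E g
        using lift g by simp
      obtain x where x: "dim (eigenspace (weighted_adj E c) x) < dim (eigenspace (L.lifted c) x)"
          "?bound < \<bar>x\<bar>"
        using g(1) by (auto simp: good_def L.lifted_def not_le)
      from L.new_eigenvector[OF x(1)] x(2) show ?thesis
        by auto
    qed
  qed (use mean \<delta> transpose_edge_deviation in auto)
  moreover have "(\<Sum>g | g \<in> W.G \<and> good g. W.w g) + (\<Sum>g | g \<in> W.G \<and> \<not> good g. W.w g) = 1"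
    unfolding W.sum_w[symmetric] using sum.Int_Diff[OF W.finite_G, of W.w "Collect good"]
    by (simp add: Int_def Diff_eq Compl_eq)
  moreover have "prob {\<omega> \<in> space \<Omega>. good (R \<omega>)} = (\<Sum>g | g \<in> W.G \<and> good g. W.w g)"
  proof -
    have "prob {\<omega> \<in> space \<Omega>. good (R \<omega>)} =
        (\<Sum>g | g \<in> W.G \<and> good g. prob {\<omega> \<in> space \<Omega>. R \<omega> = g})"
      using W.finite_G R_ev by (intro prob_finite_range) (auto simp: R_mem)
    also have "\<dots> = (\<Sum>g | g \<in> W.G \<and> good g. W.w g)"
      by (intro sum.cong refl R_prob) simp
    finally show ?thesis .
  qed
  ultimately have "1 - \<delta> \<le> prob {\<omega> \<in> space \<Omega>. good (R \<omega>)}"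
    by linarith
  \<comment> \<open>The lift reads only the matchings of edges in \<open>E\<close>, so the
    restriction in \<open>R\<close> is harmless.\<close>
  moreover have "lift_edges E (R \<omega>) = lift_edges E (\<lambda>e. M e \<omega>)" for \<omega>
    by (simp add: lift_edges_def R_def)
  ultimately show ?thesis
    by (simp add: good_def mult.assoc)
qed

section \<open>Specialization to the adjacency matrix and the Laplacian\<close>

lemma adj_matrix_eq_weighted: "adj_matrix E = weighted_adj E (\<lambda>_. 1)"
  by (simp add: adj_matrix_def weighted_adj_def)

lemma normalized_adj_component:
  "(inv_sqrt_degree_matrix E ** adj_matrix E ** inv_sqrt_degree_matrix E) $ v $ w =
    (if {v, w} \<in> E then 1 / sqrt (real (vdegree E v)) * (1 / sqrt (real (vdegree E w))) else 0)"
proof -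
  \<comment> \<open>Division by zero gives 0 in HOL, which absorbs the separate case of degree
    0.\<close>
  have T: "inv_sqrt_degree_matrix E $ x $ y = (if x = y then 1 / sqrt (real (vdegree E x)) else 0)" for x y
    by (simp add: inv_sqrt_degree_matrix_def)
  have "(inv_sqrt_degree_matrix E ** adj_matrix E) $ x $ y =
      1 / sqrt (real (vdegree E x)) * adj_matrix E $ x $ y" for x y
    by (simp add: matrix_matrix_mult_def T if_distrib[of "\<lambda>t. t * _"] cong: if_cong)
  then have "(inv_sqrt_degree_matrix E ** adj_matrix E ** inv_sqrt_degree_matrix E) $ v $ w =
      (\<Sum>x\<in>UNIV. if x = w then 1 / sqrt (real (vdegree E v)) * adj_matrix E $ v $ x *
        (1 / sqrt (real (vdegree E w))) else 0)"
    unfolding matrix_matrix_mult_def[of "_ ** _"] vec_lambda_beta by (intro sum.cong refl) (simp add: T)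
  then show ?thesis
    by (simp add: adj_matrix_def)
qed

text \<open>The product over the set of ends depends on the unordered edge only. It equals (deg v
  deg w)^(-1/2) when the ends differ, which is where simplicity of the graph enters.\<close>

definition laplacian_weight :: "'v::finite set set \<Rightarrow> 'v set \<Rightarrow> real" where
  "laplacian_weight E e = (\<Prod>v\<in>e. 1 / sqrt (real (vdegree E v)))"

lemma laplacian_eq_weighted:
  assumes "simple_graph E"
  shows "laplacian E = mat 1 - weighted_adj E (laplacian_weight E)"
proof -
  have "v \<noteq> w" if "{v, w} \<in> E" for v w
    using assms that by (fastforce simp: simple_graph_def)
  then show ?thesis
    unfolding laplacian_def
    by (auto simp: vec_eq_iff normalized_adj_component weighted_adj_def laplacian_weight_def)
qed

text \<open>Lifting preserves degrees, so the normalized weights of the lift are the pulled-back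
  weights of the base.\<close>

lemma (in lift_of_graph) laplacian_lift_eq_weighted:
  "laplacian (lift_edges E m) = mat 1 - weighted_adj (lift_edges E m) (\<lambda>e. laplacian_weight E (fst ` e))"
proof -
  have "(inv_sqrt_degree_matrix (lift_edges E m) ** adj_matrix (lift_edges E m) **
      inv_sqrt_degree_matrix (lift_edges E m)) $ x $ y =
      weighted_adj (lift_edges E m) (\<lambda>e. laplacian_weight E (fst ` e)) $ x $ y" for x y
  proof (cases "{x, y} \<in> lift_edges E m")
    case True
    then have "fst x \<noteq> fst y"
      using edge_distinct by (simp add: lift_edges_iff)
    with True show ?thesis
      using vdegree_lift[of "fst x" "snd x"] vdegree_lift[of "fst y" "snd y"]
      by (simp add: normalized_adj_component weighted_adj_def laplacian_weight_def)
  qed (simp add: normalized_adj_component weighted_adj_def)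
  then show ?thesis
    by (simp add: laplacian_def vec_eq_iff)
qed

text \<open>Explains |1 - \<beta>|: it is the modulus of the eigenvalue of T A T that corresponds to
  \<beta>.\<close>

lemma eigenspace_mat_1_diff: "eigenspace (mat 1 - N) x = eigenspace N (1 - x)"
  by (auto simp: eigenspace_def matrix_vector_mult_diff_rdistrib algebra_simps)

lemma in_new_adj_iff:
  "x \<in># new_adj E E' \<longleftrightarrow> dim (eigenspace (adj_matrix E) x) < dim (eigenspace (adj_matrix E') x)"
  by (simp add: new_adj_def in_diff_count count_spec_mset transpose_adj_matrix)

lemma in_new_lap_iff:
  "x \<in># new_lap E E' \<longleftrightarrow> dim (eigenspace (laplacian E) x) < dim (eigenspace (laplacian E') x)"
  by (simp add: new_lap_def in_diff_count count_spec_mset transpose_laplacian)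

text \<open>There are deg(v) edges at v, each of squared weight at most 1 / (deg(v) d); the degree
  of v cancels.\<close>

lemma sum_laplacian_weight_le:
  assumes simple: "simple_graph E" and d: "0 < min_degree E"
  shows "(\<Sum>e | e \<in> E \<and> v \<in> e. (laplacian_weight E e)\<^sup>2) \<le> 1 / real (min_degree E)"
proof -
  have min: "min_degree E \<le> vdegree E w" for w
    by (simp add: min_degree_def)
  have "(\<Sum>e | e \<in> E \<and> v \<in> e. (laplacian_weight E e)\<^sup>2) =
      (\<Sum>w | {v, w} \<in> E. (laplacian_weight E {v, w})\<^sup>2)"
    by (rule sum_edges_at[OF simple])
  also have "\<dots> \<le> (\<Sum>w | {v, w} \<in> E. 1 / (real (vdegree E v) * real (min_degree E)))"
  proof (intro sum_mono)
    fix w assume "w \<in> {w. {v, w} \<in> E}"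
    then have "v \<noteq> w"
      using simple by (fastforce simp: simple_graph_def)
    then have "(laplacian_weight E {v, w})\<^sup>2 = 1 / (real (vdegree E v) * real (vdegree E w))"
      by (simp add: laplacian_weight_def power_mult_distrib power_divide)
    also have "\<dots> \<le> 1 / (real (vdegree E v) * real (min_degree E))"
      using d min[of v] min[of w] by (intro divide_left_mono mult_left_mono) auto
    finally show "(laplacian_weight E {v, w})\<^sup>2 \<le> 1 / (real (vdegree E v) * real (min_degree E))" .
  qed
  also have "\<dots> = 1 / real (min_degree E)"
    using d min[of v] by (simp flip: vdegree_def)
  finally show ?thesis .
qed

theorem theorem1:
  fixes E :: "'v::finite set set"
    and n d \<Delta> k :: nat
    and \<Omega> :: "'w measure"
    and M :: "'v set \<Rightarrow> 'w \<Rightarrow> ('v \<times> 'k::finite) set set"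
    and \<delta> :: real
  assumes "simple_graph E"
    and "n = CARD('v)" and "d = min_degree E" and "\<Delta> = max_degree E"
    and "k = CARD('k)" and "k \<ge> 2"
    and "prob_space \<Omega>"
    and "\<And>\<omega>. \<omega> \<in> space \<Omega> \<Longrightarrow> lift_matchings E (\<lambda>e. M e \<omega>)"
    and "prob_space.indep_vars \<Omega> (\<lambda>_. count_space UNIV) M E"
    and "\<And>v w l r. {v, w} \<in> E \<Longrightarrow>
           measure \<Omega> {\<omega> \<in> space \<Omega>. {(v, l), (w, r)} \<in> M {v, w} \<omega>} = 1 / real k"
    and "0 < \<delta>" and "\<delta> < 1"
  shows "measure \<Omega> {\<omega> \<in> space \<Omega>.
             (SUP \<eta>\<in>set_mset (new_adj E (lift_edges E (\<lambda>e. M e \<omega>))). ereal \<bar>\<eta>\<bar>)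
               \<le> ereal (16 * sqrt (real \<Delta> * ln (2 * real n * real k / \<delta>)))} \<ge> 1 - \<delta>
       \<and> measure \<Omega> {\<omega> \<in> space \<Omega>.
             (SUP \<beta>\<in>set_mset (new_lap E (lift_edges E (\<lambda>e. M e \<omega>))). ereal \<bar>1 - \<beta>\<bar>)
               \<le> (if d = 0 then \<infinity>
                  else ereal (16 * sqrt (ln (2 * real n * real k / \<delta>) / real d)))} \<ge> 1 - \<delta>"
proof
  note k = assms(6)[unfolded assms(5)]
  have tail: "1 - \<delta> \<le> measure \<Omega> {\<omega> \<in> space \<Omega>. \<forall>x. dim (eigenspace (weighted_adj E c) x) <
      dim (eigenspace (weighted_adj (lift_edges E (\<lambda>e. M e \<omega>)) (\<lambda>e. c (fst ` e))) x) \<longrightarrow>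
      \<bar>x\<bar> \<le> 16 * sqrt (\<sigma> * ln (2 * real n * real k / \<delta>))}"
    if "\<And>v. (\<Sum>e | e \<in> E \<and> v \<in> e. (c e)\<^sup>2) \<le> \<sigma>" for c \<sigma>
    using new_eigenvalue_tail[OF assms(1) k assms(7-9) assms(10)[unfolded assms(5)] assms(11,12) that]
    unfolding assms(2,5) .
  have "(\<Sum>e | e \<in> E \<and> v \<in> e. (1::real)\<^sup>2) \<le> real \<Delta>" for v
    using sum_edges_at[OF assms(1), of "\<lambda>_. 1::real" v]
    by (simp add: assms(4) max_degree_def flip: vdegree_def)
  from tail[of "\<lambda>_. 1", OF this]
  show "measure \<Omega> {\<omega> \<in> space \<Omega>.
             (SUP \<eta>\<in>set_mset (new_adj E (lift_edges E (\<lambda>e. M e \<omega>))). ereal \<bar>\<eta>\<bar>)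
               \<le> ereal (16 * sqrt (real \<Delta> * ln (2 * real n * real k / \<delta>)))} \<ge> 1 - \<delta>"
    by (simp add: SUP_le_iff Ball_def in_new_adj_iff adj_matrix_eq_weighted)
  show "measure \<Omega> {\<omega> \<in> space \<Omega>.
             (SUP \<beta>\<in>set_mset (new_lap E (lift_edges E (\<lambda>e. M e \<omega>))). ereal \<bar>1 - \<beta>\<bar>)
               \<le> (if d = 0 then \<infinity>
                  else ereal (16 * sqrt (ln (2 * real n * real k / \<delta>) / real d)))} \<ge> 1 - \<delta>"
  proof (cases "d = 0")
    \<comment> \<open>The bound is \<infinity>, so the event is the whole space.\<close>
    case True
    then show ?thesis
      using assms(11) prob_space.prob_space[OF assms(7)] by simp
  next
    case False
    let ?N = "weighted_adj E (laplacian_weight E)"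
    let ?N' = "\<lambda>\<omega>. weighted_adj (lift_edges E (\<lambda>e. M e \<omega>)) (\<lambda>e. laplacian_weight E (fst ` e))"
    have new: "\<beta> \<in># new_lap E (lift_edges E (\<lambda>e. M e \<omega>)) \<longleftrightarrow>
        dim (eigenspace ?N (1 - \<beta>)) < dim (eigenspace (?N' \<omega>) (1 - \<beta>))"
      if "\<omega> \<in> space \<Omega>" for \<omega> \<beta>
    proof -
      interpret lift_of_graph E "\<lambda>e. M e \<omega>"
        using assms(1) assms(8)[OF that] by unfold_locales
      show ?thesis
        by (simp add: in_new_lap_iff laplacian_lift_eq_weighted laplacian_eq_weighted[OF assms(1)]
            eigenspace_mat_1_diff)
    qed
    \<comment> \<open>The reflection x = 1 - \<beta> is a bijection of the reals; it carries the
      tail bound over to the Laplacian eigenvalues.\<close>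
    have shift: "(\<forall>\<beta>. P (1 - \<beta>)) \<longleftrightarrow> (\<forall>x. P x)" for P :: "real \<Rightarrow> bool"
      by (metis diff_diff_eq2 add_diff_cancel_left' diff_add_cancel)
    have "(\<Sum>e | e \<in> E \<and> v \<in> e. (laplacian_weight E e)\<^sup>2) \<le> 1 / real d" for v
      using sum_laplacian_weight_le[OF assms(1)] False unfolding assms(3) by simp
    note tail[OF this]
    also have "{\<omega> \<in> space \<Omega>. \<forall>x. dim (eigenspace ?N x) < dim (eigenspace (?N' \<omega>) x) \<longrightarrow>
          \<bar>x\<bar> \<le> 16 * sqrt (1 / real d * ln (2 * real n * real k / \<delta>))} =
        {\<omega> \<in> space \<Omega>. (SUP \<beta>\<in>set_mset (new_lap E (lift_edges E (\<lambda>e. M e \<omega>))). ereal \<bar>1 - \<beta>\<bar>)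
               \<le> (if d = 0 then \<infinity>
                  else ereal (16 * sqrt (ln (2 * real n * real k / \<delta>) / real d)))}"
      using False by (subst shift[symmetric]) (auto simp: SUP_le_iff new)
    finally show ?thesis .
  qed
qed

end
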